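(* Let $K$ be a number field with ring of integers $\mathcal{O}_K$, let $M$ be a finitely-generated projective $\mathcal{O}_K$-module and let $\mathcal{S}$ be an infinite set of positive integers. If $T\in\operatorname{End}_{\mathcal{O}_K}(M)$ is one-to-one and $\mathcal{S}$-divisible, then $T$ is of finite order coprime to every $p\in\Pi_{\mathcal{S}}$. In particular, $T=1$ provided that for every prime $p$ there are elements of $\mathcal{S}$ divisible by arbitrarily high powers of $p$.
   Context: $T\in\operatorname{End}_{\mathcal{O}_K}(M)$ is $\mathcal{S}$-divisible if for every $s\in\mathcal{S}$ there is $T_s\in\operatorname{End}_{\mathcal{O}_K}(M)$ with $T_s^s=T$. $\Pi_{\mathcal{S}}$ is the set of primes $p$ such that $\sup_{s\in\mathcal{S}}\nu_p(s)=\infty$, where $\nu_p$ is the $p$-adic valuation. A number field is a finite extension of $\mathbb{Q}$, and its ring of integers (the "number ring") consists of the algebraic integers it contains. *)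

theory Defs
  imports
    "HOL-Algebra.Algebra"
    "HOL-Computational_Algebra.Computational_Algebra"
    "HOL-Library.Extended_Nat"
begin

section \<open>Number fields and their rings of integers\<close>

text \<open>
  A number field is given as a type of class \<open>field_char_0\<close> (so that it contains the rationals
  via \<^const>\<open>of_rat\<close>) which has a finite basis as a vector space over \<^typ>\<open>rat\<close>.
\<close>
definition number_field :: "'k::field_char_0 itself \<Rightarrow> bool" where
  "number_field _ \<longleftrightarrow>
     (\<exists>B. finite_dimensional_vector_space (\<lambda>(q::rat) (x::'k). of_rat q * x) B)"

definition ring_of_integers :: "'k::field_char_0 ring" where
  "ring_of_integers =
     \<lparr>carrier = {x. algebraic_int x}, monoid.mult = (*), monoid.one = 1,
      ring.zero = 0, ring.add = (+)\<rparr>"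

section \<open>Modules\<close>

definition module_hom ::
  "('a, 'r) ring_scheme \<Rightarrow> ('a, 'b, 'm) module_scheme \<Rightarrow> ('a, 'c, 'n) module_scheme \<Rightarrow> ('b \<Rightarrow> 'c) set"
  where "module_hom R M N =
    {f \<in> hom (add_monoid M) (add_monoid N).
       \<forall>a\<in>carrier R. \<forall>x\<in>carrier M. f (a \<odot>\<^bsub>M\<^esub> x) = a \<odot>\<^bsub>N\<^esub> f x}"

text \<open>
  The multiplicative monoid of the endomorphism ring. Endomorphisms are extensional functions
  (as in \<^const>\<open>BijGroup\<close>), so that equality in HOL is equality of endomorphisms.
\<close>
definition module_End ::
  "('a, 'r) ring_scheme \<Rightarrow> ('a, 'b, 'm) module_scheme \<Rightarrow> ('b \<Rightarrow> 'b) monoid"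
  where "module_End R M =
    \<lparr>carrier = module_hom R M M \<inter> extensional (carrier M),
     monoid.mult = compose (carrier M),
     monoid.one = (\<lambda>x\<in>carrier M. x)\<rparr>"

lemma monoid_module_End:
  assumes "module R M"
  shows "monoid (module_End R M)"
proof -
  interpret module R M by (fact assms)
  show ?thesis
  proof (rule monoidI, goal_cases)
    case (1 f g)
    then show ?case
      by (auto simp: module_End_def module_hom_def hom_def compose_def Pi_iff)
  next
    case 2
    then show ?case by (auto simp: module_End_def module_hom_def hom_def)
  next
    case (3 f g h)
    then show ?case
      by (auto simp: module_End_def module_hom_def hom_def compose_def Pi_iff restrict_def)
  next
    case (4 f)
    then show ?case
      by (auto simp: module_End_def module_hom_def hom_def intro!: Id_compose)
  next
    case (5 f)
    then show ?case
      by (auto simp: module_End_def module_hom_def hom_def intro!: compose_Id)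
  qed
qed

definition finitely_generated ::
  "('a, 'r) ring_scheme \<Rightarrow> ('a, 'b, 'm) module_scheme \<Rightarrow> bool"
  where "finitely_generated R M \<longleftrightarrow>
    (\<exists>A. finite A \<and> A \<subseteq> carrier M \<and> (\<forall>N. submodule N R M \<and> A \<subseteq> N \<longrightarrow> N = carrier M))"

text \<open>
  The free module on the set \<open>I\<close>: finitely supported families in \<open>R\<close> indexed by \<open>I\<close>, extended
  by zero outside \<open>I\<close>. The ring fields \<open>mult\<close> and \<open>one\<close> of a module record carry no meaning.
\<close>
definition free_module :: "('a, 'r) ring_scheme \<Rightarrow> 'i set \<Rightarrow> ('a, 'i \<Rightarrow> 'a) module" where
  "free_module R I =
    \<lparr>carrier = {f. (\<forall>i. f i \<in> carrier R) \<and> {i. f i \<noteq> \<zero>\<^bsub>R\<^esub>} \<subseteq> I \<and> finite {i. f i \<noteq> \<zero>\<^bsub>R\<^esub>}},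
     monoid.mult = undefined,
     monoid.one = undefined,
     ring.zero = (\<lambda>i. \<zero>\<^bsub>R\<^esub>),
     ring.add = (\<lambda>f g i. f i \<oplus>\<^bsub>R\<^esub> g i),
     module.smult = (\<lambda>a f i. a \<otimes>\<^bsub>R\<^esub> f i)\<rparr>"

lemma module_free_module:
  fixes R :: "('a, 'r) ring_scheme" and I :: "'i set"
  assumes "cring R"
  shows "module R (free_module R I)"
proof -
  interpret cring R by (fact assms)
  have supp: "finite {i. f i \<oplus>\<^bsub>R\<^esub> g i \<noteq> \<zero>\<^bsub>R\<^esub>}"
    if "finite {i. f i \<noteq> \<zero>\<^bsub>R\<^esub>}" "finite {i. g i \<noteq> \<zero>\<^bsub>R\<^esub>}" for f g :: "'i \<Rightarrow> 'a"
    by (rule finite_subset[OF _ finite_UnI[OF that]]) auto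
  have supp_smult: "finite {i. a \<otimes>\<^bsub>R\<^esub> f i \<noteq> \<zero>\<^bsub>R\<^esub>}"
    if "a \<in> carrier R" "finite {i. f i \<noteq> \<zero>\<^bsub>R\<^esub>}" for a and f :: "'i \<Rightarrow> 'a"
    by (rule finite_subset[OF _ that(2)]) (use that(1) in auto)
  have inv: "\<exists>g\<in>carrier (free_module R I). g \<oplus>\<^bsub>free_module R I\<^esub> f = \<zero>\<^bsub>free_module R I\<^esub>"
    if "f \<in> carrier (free_module R I)" for f
  proof
    have eq: "\<ominus>\<^bsub>R\<^esub> f i = \<zero>\<^bsub>R\<^esub> \<longleftrightarrow> f i = \<zero>\<^bsub>R\<^esub>" for i
      using that minus_minus[of "f i"] by (force simp: free_module_def)
    show "(\<lambda>i. \<ominus>\<^bsub>R\<^esub> f i) \<in> carrier (free_module R I)"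
      using that unfolding free_module_def by (simp add: eq)
    show "(\<lambda>i. \<ominus>\<^bsub>R\<^esub> f i) \<oplus>\<^bsub>free_module R I\<^esub> f = \<zero>\<^bsub>free_module R I\<^esub>"
      using that by (auto simp: free_module_def l_neg)
  qed
  show ?thesis
  proof (rule moduleI)
    show "abelian_group (free_module R I)"
    proof (rule abelian_groupI, goal_cases)
      case (1 f g)
      then have "{i. f i \<oplus>\<^bsub>R\<^esub> g i \<noteq> \<zero>\<^bsub>R\<^esub>} \<subseteq> I"
        by (force simp: free_module_def)
      with 1 show ?case by (simp add: free_module_def supp)
    next
      case (6 f)
      then show ?case by (rule inv)
    qed (auto simp: free_module_def a_ac fun_eq_iff)
  next
    fix a f
    assume "a \<in> carrier R" "f \<in> carrier (free_module R I)"
    moreover from this have "{i. a \<otimes>\<^bsub>R\<^esub> f i \<noteq> \<zero>\<^bsub>R\<^esub>} \<subseteq> I"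
      by (force simp: free_module_def)
    ultimately show "a \<odot>\<^bsub>free_module R I\<^esub> f \<in> carrier (free_module R I)"
      by (simp add: free_module_def supp_smult)
  qed (auto simp: free_module_def l_distr r_distr m_assoc fun_eq_iff assms)
qed

text \<open>
  A module is projective if it is isomorphic to a direct summand of a free module. It is no
  restriction that the basis \<open>I\<close> lives in the type of elements of \<open>M\<close>: a projective module is
  already a direct summand of the free module on its own carrier.
\<close>
definition projective_module ::
  "('a, 'r) ring_scheme \<Rightarrow> ('a, 'b, 'm) module_scheme \<Rightarrow> bool"
  where "projective_module R M \<longleftrightarrow>
    (\<exists>(I :: 'b set) P Q.
       submodule P R (free_module R I) \<and> submodule Q R (free_module R I) \<and>
       P \<inter> Q = {\<zero>\<^bsub>free_module R I\<^esub>} \<and>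
       P <+>\<^bsub>free_module R I\<^esub> Q = carrier (free_module R I) \<and>
       (\<exists>h \<in> module_hom R M (free_module R I\<lparr>carrier := P\<rparr>). bij_betw h (carrier M) P))"

section \<open>Divisibility and orders in monoids\<close>

definition S_divisible :: "nat set \<Rightarrow> ('a, 'b) monoid_scheme \<Rightarrow> 'a \<Rightarrow> bool" where
  "S_divisible S G x \<longleftrightarrow> (\<forall>s\<in>S. \<exists>y\<in>carrier G. y [^]\<^bsub>G\<^esub> s = x)"

definition has_finite_order :: "('a, 'b) monoid_scheme \<Rightarrow> 'a \<Rightarrow> bool" where
  "has_finite_order G x \<longleftrightarrow> (\<exists>n::nat. 0 < n \<and> x [^]\<^bsub>G\<^esub> n = \<one>\<^bsub>G\<^esub>)"

text \<open>
  The library's \<^const>\<open>group.ord\<close> is only available in groups. The value below is meaningful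
  only for elements of finite order.
\<close>
definition order_of :: "('a, 'b) monoid_scheme \<Rightarrow> 'a \<Rightarrow> nat" where
  "order_of G x = (LEAST n. 0 < n \<and> x [^]\<^bsub>G\<^esub> n = \<one>\<^bsub>G\<^esub>)"

lemma (in group) order_of_eq_ord:
  assumes "x \<in> carrier G" "has_finite_order G x"
  shows "order_of G x = ord x"
proof -
  have "ord x > 0"
    using assms ord_eq_0 by (auto simp: has_finite_order_def)
  then show ?thesis
    unfolding order_of_def using assms(1)
    by (intro Least_equality) (auto simp: pow_eq_id intro: dvd_imp_le)
qed

definition Pi_set :: "nat set \<Rightarrow> nat set" where
  "Pi_set S = {p. Factorial_Ring.prime p \<and> (SUP s\<in>S. enat (multiplicity p s)) = \<infinity>}"

end

theory Submission
  imports Defs "Jordan_Normal_Form.Schur_Decomposition"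
begin

text \<open>
  The trace form embeds the ring of integers, and with it \<open>M\<close>, into a finitely generated free abelian
  group. Hence \<open>M\<close> is itself free of finite rank over \<open>\<int>\<close> and \<open>T\<close> and its roots \<open>T\<^sub>s\<close> become integer matrices.
  The eigenvalues of \<open>T\<^sub>s\<close> are \<open>s\<close>-th roots of those of \<open>T\<close>, so only finitely many characteristic
  polynomials occur. If infinitely many \<open>T\<^sub>s\<close> share one of them, then for each of its roots \<open>\<mu>\<close> two of the
  powers \<open>\<mu>\<^sup>s\<close> agree, so all eigenvalues are roots of unity and some \<open>N > 0\<close> makes every \<open>T\<^sub>s\<^sup>N\<close> unipotent.
  If \<open>k + 1\<close> is the nilpotency index of \<open>T\<^sup>N - 1\<close>, expanding \<open>T\<^sup>N = (1 + (T\<^sub>s\<^sup>N - 1))\<^sup>s\<close> gives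
  \<open>(T\<^sup>N - 1)\<^sup>k = s\<^sup>k (T\<^sub>s\<^sup>N - 1)\<^sup>k\<close> for every \<open>s\<close>, which forces \<open>k = 0\<close>. So \<open>T\<^sub>s\<^sup>N = 1\<close> for all \<open>s\<close>, and if
  \<open>N = p\<^sup>a m\<close> and \<open>p\<^sup>a\<close> divides \<open>s\<close> then \<open>T\<^sup>m = 1\<close>.
\<close>

section \<open>Polynomials in a matrix\<close>

text \<open>Entrywise, because matrices of all sizes together form no ring in which
  \<open>poly\<close> could be evaluated.\<close>

definition poly_mat :: "'a::comm_ring_1 mat \<Rightarrow> 'a poly \<Rightarrow> 'a mat" where
  "poly_mat Y p = mat (dim_row Y) (dim_row Y)
     (\<lambda>(i, j). \<Sum>k\<le>degree p. coeff p k * (Y ^\<^sub>m k) $$ (i, j))"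

lemma poly_mat_carrier [simp]: "Y \<in> carrier_mat n n \<Longrightarrow> poly_mat Y p \<in> carrier_mat n n"
  by (auto simp: poly_mat_def)

lemma poly_mat_dim [simp]: "dim_row (poly_mat Y p) = dim_row Y" "dim_col (poly_mat Y p) = dim_row Y"
  by (auto simp: poly_mat_def)

text \<open>Coefficients beyond the degree vanish, so polynomials of different degrees can be
  compared over a common summation range.\<close>

lemma poly_mat_index:
  assumes "degree p \<le> m" "i < dim_row Y" "j < dim_row Y"
  shows "poly_mat Y p $$ (i, j) = (\<Sum>k\<le>m. coeff p k * (Y ^\<^sub>m k) $$ (i, j))"
proof -
  have "(\<Sum>k\<le>degree p. coeff p k * (Y ^\<^sub>m k) $$ (i, j)) = (\<Sum>k\<le>m. coeff p k * (Y ^\<^sub>m k) $$ (i, j))"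
    using assms(1) by (intro sum.mono_neutral_left) (auto simp: coeff_eq_0)
  then show ?thesis using assms by (simp add: poly_mat_def)
qed

lemma poly_mat_add:
  "poly_mat Y (p + q) = poly_mat Y p + poly_mat Y q"
proof (rule eq_matI)
  fix i j assume ij: "i < dim_row (poly_mat Y p + poly_mat Y q)" "j < dim_col (poly_mat Y p + poly_mat Y q)"
  define m where "m = max (degree p) (degree q)"
  have "degree p \<le> m" "degree q \<le> m" "degree (p + q) \<le> m"
    by (auto simp: m_def degree_add_le)
  then show "poly_mat Y (p + q) $$ (i, j) = (poly_mat Y p + poly_mat Y q) $$ (i, j)"
    using ij by (simp add: poly_mat_index sum.distrib algebra_simps)
qed auto

lemma poly_mat_0 [simp]: "Y \<in> carrier_mat n n \<Longrightarrow> poly_mat Y 0 = 0\<^sub>m n n"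
  by (auto simp: poly_mat_def)

lemma poly_mat_smult: "poly_mat Y (Polynomial.smult a p) = a \<cdot>\<^sub>m poly_mat Y p"
proof (rule eq_matI)
  fix i j assume "i < dim_row (a \<cdot>\<^sub>m poly_mat Y p)" "j < dim_col (a \<cdot>\<^sub>m poly_mat Y p)"
  then show "poly_mat Y (Polynomial.smult a p) $$ (i, j) = (a \<cdot>\<^sub>m poly_mat Y p) $$ (i, j)"
    using poly_mat_index[OF degree_smult_le[of a p], of i Y j]
    by (simp add: poly_mat_index[OF order_refl] sum_distrib_left mult.assoc)
qed auto

lemma poly_mat_uminus:
  assumes "Y \<in> carrier_mat n n"
  shows "poly_mat Y (- p) = - poly_mat Y p"
  using poly_mat_smult[of Y "-1" p] assms by auto

lemma poly_mat_minus:
  assumes "Y \<in> carrier_mat n n"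
  shows "poly_mat Y (p - q) = poly_mat Y p - poly_mat Y q"
  using poly_mat_add[of Y p "- q"] assms by (auto simp: poly_mat_uminus)

lemma poly_mat_sum:
  assumes "Y \<in> carrier_mat n n" "i < n" "j < n"
  shows "poly_mat Y (sum f A) $$ (i, j) = (\<Sum>a\<in>A. poly_mat Y (f a) $$ (i, j))"
  using assms by (induction A rule: infinite_finite_induct) (auto simp: poly_mat_add)

text \<open>Horner's rule: shifting the index splits off the constant term and leaves a factor
  \<open>Y\<close> on the right. Inductions over polynomials use this form.\<close>

lemma poly_mat_pCons:
  assumes Y: "Y \<in> carrier_mat n n"
  shows "poly_mat Y (pCons a p) = a \<cdot>\<^sub>m 1\<^sub>m n + poly_mat Y p * Y"
proof (rule eq_matI)
  fix i j assume "i < dim_row (a \<cdot>\<^sub>m 1\<^sub>m n + poly_mat Y p * Y)" "j < dim_col (a \<cdot>\<^sub>m 1\<^sub>m n + poly_mat Y p * Y)"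
  with Y have ij: "i < n" "j < n" by auto
  have "poly_mat Y (pCons a p) $$ (i, j) =
    (\<Sum>k\<le>Suc (degree p). coeff (pCons a p) k * (Y ^\<^sub>m k) $$ (i, j))"
    using Y ij by (intro poly_mat_index) (auto simp: degree_pCons_le)
  also have "\<dots> = a * 1\<^sub>m n $$ (i, j) + (\<Sum>k\<le>degree p. coeff p k * (Y ^\<^sub>m k * Y) $$ (i, j))"
    using Y by (simp add: sum.atMost_Suc_shift del: sum.atMost_Suc)
  also have "(\<Sum>k\<le>degree p. coeff p k * (Y ^\<^sub>m k * Y) $$ (i, j)) =
    (\<Sum>k\<le>degree p. \<Sum>l=0..<n. coeff p k * (Y ^\<^sub>m k) $$ (i, l) * Y $$ (l, j))"
    using Y ij by (simp add: scalar_prod_def sum_distrib_left mult.assoc)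
  also have "\<dots> = (\<Sum>l=0..<n. \<Sum>k\<le>degree p. coeff p k * (Y ^\<^sub>m k) $$ (i, l) * Y $$ (l, j))"
    by (rule sum.swap)
  also have "\<dots> = (poly_mat Y p * Y) $$ (i, j)"
    using Y ij by (simp add: scalar_prod_def poly_mat_index[OF order_refl] sum_distrib_right)
  finally show "poly_mat Y (pCons a p) $$ (i, j) = (a \<cdot>\<^sub>m 1\<^sub>m n + poly_mat Y p * Y) $$ (i, j)"
    using Y ij by simp
qed (use Y in auto)

lemma poly_mat_mult:
  assumes Y: "Y \<in> carrier_mat n n"
  shows "poly_mat Y (p * q) = poly_mat Y p * poly_mat Y q"
proof (induction q)
  case 0
  have "poly_mat Y p * 0\<^sub>m n n = 0\<^sub>m n n"
    using Y by (intro right_mult_zero_mat) auto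
  then show ?case using Y by simp
next
  case (pCons a q)
  note c = poly_mat_carrier[OF Y]
  have "poly_mat Y (p * pCons a q) = poly_mat Y (Polynomial.smult a p + pCons 0 (p * q))"
    by simp
  also have "\<dots> = a \<cdot>\<^sub>m poly_mat Y p + (0 \<cdot>\<^sub>m 1\<^sub>m n + poly_mat Y p * poly_mat Y q * Y)"
    by (simp only: poly_mat_add poly_mat_smult poly_mat_pCons[OF Y] pCons.IH)
  also have "0 \<cdot>\<^sub>m 1\<^sub>m n + poly_mat Y p * poly_mat Y q * Y = poly_mat Y p * (poly_mat Y q * Y)"
  proof -
    have "0 \<cdot>\<^sub>m 1\<^sub>m n = (0\<^sub>m n n :: 'a mat)" by auto
    moreover have "poly_mat Y p * poly_mat Y q * Y = poly_mat Y p * (poly_mat Y q * Y)"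
      using Y c by (meson assoc_mult_mat)
    moreover have "poly_mat Y p * (poly_mat Y q * Y) \<in> carrier_mat n n"
      using Y c by (meson mult_carrier_mat)
    ultimately show ?thesis by (metis left_add_zero_mat)
  qed
  also have "a \<cdot>\<^sub>m poly_mat Y p + poly_mat Y p * (poly_mat Y q * Y) =
     poly_mat Y p * (a \<cdot>\<^sub>m 1\<^sub>m n + poly_mat Y q * Y)"
    using Y c[of p] c[of q]
    by (subst mult_add_distrib_mat[of _ n n]) (auto simp: mult_smult_distrib[of _ n n _ n])
  finally show ?case by (simp add: poly_mat_pCons[OF Y])
qed

lemma poly_mat_1 [simp]: "Y \<in> carrier_mat n n \<Longrightarrow> poly_mat Y 1 = 1\<^sub>m n"
  using poly_mat_pCons[of Y n 1 0] by (auto simp: one_pCons left_mult_zero_mat)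

lemma poly_mat_monom: "Y \<in> carrier_mat n n \<Longrightarrow> poly_mat Y (monom 1 k) = Y ^\<^sub>m k"
  by (induction k) (auto simp: monom_Suc poly_mat_pCons)

lemma poly_mat_power:
  assumes Y: "Y \<in> carrier_mat n n"
  shows "poly_mat Y (p ^ k) = poly_mat Y p ^\<^sub>m k"
  by (induction k) (use Y in \<open>auto simp: poly_mat_mult power_Suc2 simp del: power_Suc\<close>)

text \<open>
  Over the polynomials in \<open>Y\<close> the \<open>(l, j)\<close> entry of \<open>F B\<close> is the coordinate \<open>l\<close> of \<open>\<Sum>i. B\<^sub>i\<^sub>j(Y) e\<^sub>i\<close>;
  the additive map \<open>F\<close> kills the multiples of \<open>x - Y\<close>.
\<close>
theorem Cayley_Hamilton:
  assumes Y: "Y \<in> carrier_mat n n"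
  shows "poly_mat Y (char_poly Y) = 0\<^sub>m n n"
proof -
  define C where "C = char_poly_matrix Y"
  \<comment> \<open>The adjugate makes \<open>C * B\<close> equal to \<open>char_poly Y\<close>
    times the identity, so \<open>F (C * B)\<close> yields the entries of
    \<open>poly_mat Y (char_poly Y)\<close>. It remains to see that \<open>F (C * B)\<close>
    vanishes.\<close>
  define B where "B = adj_mat C"
  define F where "F = (\<lambda>A l j. \<Sum>i<n. poly_mat Y (A $$ (i, j)) $$ (l, i))"
  have C: "C \<in> carrier_mat n n" using Y by (simp add: C_def)
  note B = adj_mat[OF C, folded B_def]
  have Cim: "C $$ (i, m) = (if i = m then [:0, 1:] else 0) - [:Y $$ (i, m):]" if "i < n" "m < n" for i m
    using that Y by (auto simp: C_def char_poly_matrix_def)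
  have *: "poly_mat Y (C $$ (i, m)) = (if i = m then Y else 0\<^sub>m n n) - Y $$ (i, m) \<cdot>\<^sub>m 1\<^sub>m n"
    if "i < n" "m < n" for i m
    using that Y by (auto simp: Cim poly_mat_minus poly_mat_pCons left_mult_zero_mat poly_mat_monom one_pCons)
  have F: "F (C * B) l j = 0" if lj: "l < n" "j < n" for l j
  proof -
    let ?b = "\<lambda>m. poly_mat Y (B $$ (m, j))"
    have b: "?b m \<in> carrier_mat n n" for m using Y by simp
    have "F (C * B) l j = (\<Sum>i<n. poly_mat Y (\<Sum>m<n. B $$ (m, j) * C $$ (i, m)) $$ (l, i))"
    proof -
      have "(C * B) $$ (i, j) = (\<Sum>m<n. B $$ (m, j) * C $$ (i, m))" if "i < n" for i
        using that lj C B(1) by (simp add: scalar_prod_def atLeast0LessThan mult.commute)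
      then show ?thesis by (simp add: F_def)
    qed
    also have "\<dots> = (\<Sum>i<n. \<Sum>m<n. (?b m * poly_mat Y (C $$ (i, m))) $$ (l, i))"
      using lj Y by (simp add: poly_mat_sum poly_mat_mult)
    also have "\<dots> = (\<Sum>m<n. \<Sum>i<n. (?b m * poly_mat Y (C $$ (i, m))) $$ (l, i))"
      by (rule sum.swap)
    also have "\<dots> = 0"
    proof (rule sum.neutral, safe)
      \<comment> \<open>The diagonal term \<open>i = m\<close> contributes the entry
        \<open>(l, m)\<close> of \<open>?b m * Y\<close>; the scalar terms subtract the same entry
        written out as a matrix product.\<close>
      fix m assume m: "m < n"
      have "(?b m * poly_mat Y (C $$ (i, m))) $$ (l, i) =
         (if i = m then (?b m * Y) $$ (l, i) else 0) - Y $$ (i, m) * ?b m $$ (l, i)" if "i < n" for i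
      proof -
        let ?D = "if i = m then Y else 0\<^sub>m n n"
        have "?b m * poly_mat Y (C $$ (i, m)) = ?b m * ?D - ?b m * (Y $$ (i, m) \<cdot>\<^sub>m 1\<^sub>m n)"
          unfolding *[OF that m] using b[of m] Y by (intro mult_minus_distrib_mat) auto
        also have "?b m * (Y $$ (i, m) \<cdot>\<^sub>m 1\<^sub>m n) = Y $$ (i, m) \<cdot>\<^sub>m ?b m"
          using b[of m] by (simp add: mult_smult_distrib[of _ n n _ n] right_mult_one_mat[of _ n n])
        finally show ?thesis
          using that lj Y b[of m] by auto
      qed
      then have "(\<Sum>i<n. (?b m * poly_mat Y (C $$ (i, m))) $$ (l, i)) =
        (\<Sum>i<n. if i = m then (?b m * Y) $$ (l, i) else 0) - (\<Sum>i<n. Y $$ (i, m) * ?b m $$ (l, i))"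
        by (simp add: sum_subtractf)
      also have "(\<Sum>i<n. if i = m then (?b m * Y) $$ (l, i) else 0) = (?b m * Y) $$ (l, m)"
        using m by simp
      also have "\<dots> = (\<Sum>i<n. Y $$ (i, m) * ?b m $$ (l, i))"
        using m lj Y by (simp add: scalar_prod_def atLeast0LessThan mult.commute)
      finally show "(\<Sum>i<n. (?b m * poly_mat Y (C $$ (i, m))) $$ (l, i)) = 0" by simp
    qed
    finally show ?thesis .
  qed
  show ?thesis
  proof (rule eq_matI)
    fix l j assume "l < dim_row (0\<^sub>m n n :: 'a mat)" "j < dim_col (0\<^sub>m n n :: 'a mat)"
    then have lj: "l < n" "j < n" by auto
    have "0 = (\<Sum>i<n. poly_mat Y ((char_poly Y \<cdot>\<^sub>m 1\<^sub>m n) $$ (i, j)) $$ (l, i))"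
      using F[OF lj] B(2) by (simp add: F_def C_def char_poly_def)
    also have "\<dots> = (\<Sum>i<n. if i = j then poly_mat Y (char_poly Y) $$ (l, i) else 0)"
      using lj Y by (intro sum.cong) auto
    also have "\<dots> = poly_mat Y (char_poly Y) $$ (l, j)"
      using lj by simp
    finally show "poly_mat Y (char_poly Y) $$ (l, j) = 0\<^sub>m n n $$ (l, j)"
      using lj by simp
  qed (use Y in auto)
qed

section \<open>Roots of integer matrices\<close>

text \<open>First-order part of the binomial expansion of \<open>(1 + (y - 1)) ^ s\<close>; only the
  linear coefficient \<open>s\<close> matters, so the remainder stays an unspecified
  \<open>q\<close>.\<close>

lemma power_minus_one_expand:
  fixes y :: "'a::comm_ring_1"
  shows "\<exists>q. y ^ s - 1 = (y - 1) * (of_nat s + (y - 1) * q)"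
proof (induction s)
  case (Suc s)
  then obtain q where q: "y ^ s - 1 = (y - 1) * (of_nat s + (y - 1) * q)" by blast
  have "y ^ Suc s - 1 = y * (y ^ s - 1) + (y - 1)" by (simp add: algebra_simps)
  also have "\<dots> = (y - 1) * (of_nat (Suc s) + (y - 1) * (of_nat s + y * q))"
    unfolding q by (simp add: algebra_simps)
  finally show ?case by blast
qed (auto intro: exI[of _ 0])

text \<open>In the \<open>k\<close>-th power of the first-order expansion the lowest coefficient is
  \<open>s ^ k\<close>, the source of all later divisibility by \<open>s\<close>.\<close>

lemma power_power_minus_one_expand:
  fixes y :: "'a::comm_ring_1"
  shows "\<exists>q. (y ^ s - 1) ^ k = of_nat (s ^ k) * (y - 1) ^ k + (y - 1) ^ Suc k * q"
proof (induction k)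
  case (Suc k)
  then obtain q where q: "(y ^ s - 1) ^ k = of_nat (s ^ k) * (y - 1) ^ k + (y - 1) ^ Suc k * q"
    by blast
  obtain q' where q': "y ^ s - 1 = (y - 1) * (of_nat s + (y - 1) * q')"
    using power_minus_one_expand by blast
  have "(y ^ s - 1) ^ Suc k = (y ^ s - 1) * (y ^ s - 1) ^ k" by simp
  also have "\<dots> = of_nat (s ^ Suc k) * (y - 1) ^ Suc k +
      (y - 1) ^ Suc (Suc k) * (of_nat s * q + q' * of_nat (s ^ k) + q' * (y - 1) * q)"
    unfolding q unfolding q' by (simp add: algebra_simps)
  finally show ?case by blast
qed (auto intro: exI[of _ 0])

text \<open>Descent on the exponent of \<open>y - 1\<close> down to \<open>k\<close>.
  \<open>I\<close> will be the ideal of polynomials annihilating an integer matrix, which is closed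
  under division by positive integers.\<close>

lemma power_mem_of_power_power_minus_one_mem:
  fixes y :: "'a::comm_ring_1"
  assumes mult: "\<And>p q. p \<in> I \<Longrightarrow> q * p \<in> I"
    and diff: "\<And>p q. p \<in> I \<Longrightarrow> q \<in> I \<Longrightarrow> p - q \<in> I"
    and torsion: "\<And>p m. m > 0 \<Longrightarrow> of_nat m * p \<in> I \<Longrightarrow> p \<in> I"
    and nil: "(y - 1) ^ r \<in> I" and "(y ^ s - 1) ^ k \<in> I" "s > 0"
  shows "(y - 1) ^ k \<in> I"
proof -
  have "(y - 1) ^ k \<in> I" if "(y - 1) ^ (k + j) \<in> I" for j
    using that
  proof (induction j)
    case (Suc j)
    obtain q where q: "(y ^ s - 1) ^ k = of_nat (s ^ k) * (y - 1) ^ k + (y - 1) ^ Suc k * q"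
      using power_power_minus_one_expand by blast
    \<comment> \<open>The subtracted element of \<open>I\<close> cancels the higher-order term of
      the expansion; what is left is \<open>s ^ k\<close> times the next lower power, and
      \<open>torsion\<close> removes the factor.\<close>
    have "(y - 1) ^ j * (y ^ s - 1) ^ k - q * (y - 1) ^ (k + Suc j) \<in> I"
      using assms(5) Suc.prems by (intro diff mult)
    also have "(y - 1) ^ j * (y ^ s - 1) ^ k - q * (y - 1) ^ (k + Suc j) =
        of_nat (s ^ k) * (y - 1) ^ (k + j)"
    proof -
      have "w ^ j * (a * w ^ k + w ^ Suc k * q) - q * w ^ (k + Suc j) = a * w ^ (k + j)" for w a :: 'a
        by (simp add: algebra_simps power_add)
      then show ?thesis unfolding q .
    qed
    finally have "(y - 1) ^ (k + j) \<in> I"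
      using \<open>s > 0\<close> torsion[of "s ^ k"] by simp
    then show ?case by (rule Suc.IH)
  qed simp
  \<comment> \<open>Starting at \<open>k + r\<close> instead of \<open>r\<close> avoids comparing
    \<open>k\<close> with \<open>r\<close>.\<close>
  moreover have "(y - 1) ^ (k + r) \<in> I"
    using mult[OF nil, of "(y - 1) ^ k"] by (simp add: power_add)
  ultimately show ?thesis by blast
qed

section \<open>Polynomial evaluation under scalar extension, on eigenvectors and at powers\<close>

lemma poly_mat_of_int_hom:
  assumes Y: "Y \<in> carrier_mat n n"
  shows "poly_mat (map_mat of_int Y) (map_poly of_int p :: 'a::comm_ring_1 poly) = map_mat of_int (poly_mat Y p)"
proof (induction p)
  case (pCons a p)
  have "poly_mat (map_mat of_int Y) (map_poly of_int (pCons a p) :: 'a poly) =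
     of_int a \<cdot>\<^sub>m 1\<^sub>m n + map_mat of_int (poly_mat Y p) * map_mat of_int Y"
    using Y by (simp add: of_int_hom.map_poly_pCons_hom poly_mat_pCons[of _ n] pCons.IH)
  also have "map_mat of_int (poly_mat Y p) * map_mat of_int Y = (map_mat of_int (poly_mat Y p * Y) :: 'a mat)"
    using Y by (subst of_int_hom.mat_hom_mult[of _ n n _ n]) auto
  finally show ?case
    using Y by (auto simp: poly_mat_pCons[of Y n])
qed (use Y in auto)

lemma poly_mat_eigenvector:
  assumes Y: "Y \<in> carrier_mat n n" and "eigenvector Y v k"
  shows "poly_mat Y p *\<^sub>v v = poly p k \<cdot>\<^sub>v v"
proof -
  have v: "v \<in> carrier_vec n" and ev: "Y *\<^sub>v v = k \<cdot>\<^sub>v v"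
    using assms by (auto simp: eigenvector_def)
  show ?thesis
  proof (induction p)
    case 0
    then show ?case using Y v by auto
  next
    case (pCons a p)
    have c: "poly_mat Y p \<in> carrier_mat n n" using Y by simp
    have "poly_mat Y (pCons a p) *\<^sub>v v = (a \<cdot>\<^sub>m 1\<^sub>m n) *\<^sub>v v + (poly_mat Y p * Y) *\<^sub>v v"
      unfolding poly_mat_pCons[OF Y] using Y c v by (intro add_mult_distrib_mat_vec) auto
    also have "(a \<cdot>\<^sub>m 1\<^sub>m n) *\<^sub>v v = a \<cdot>\<^sub>v v"
      using v by (intro eq_vecI) auto
    also have "(poly_mat Y p * Y) *\<^sub>v v = poly_mat Y p *\<^sub>v (Y *\<^sub>v v)"
      using Y c v by (intro assoc_mult_mat_vec)
    also have "\<dots> = k \<cdot>\<^sub>v (poly_mat Y p *\<^sub>v v)"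
      unfolding ev using c v by (intro eq_vecI) auto
    also have "\<dots> = k \<cdot>\<^sub>v (poly p k \<cdot>\<^sub>v v)" by (simp add: pCons.IH)
    also have "a \<cdot>\<^sub>v v + \<dots> = poly (pCons a p) k \<cdot>\<^sub>v v"
      using v by (auto simp: algebra_simps)
    finally show ?case .
  qed
qed

text \<open>Substituting \<open>X ^ s\<close> for \<open>X\<close> amounts to replacing
  \<open>Y\<close> by its \<open>s\<close>-th power. This carries annihilating polynomials back and
  forth between \<open>T\<close> and its roots.\<close>

lemma poly_mat_power_minus_one:
  assumes Y: "Y \<in> carrier_mat n n"
  shows "poly_mat Y ((monom 1 (s * m) - 1) ^ k) = poly_mat (Y ^\<^sub>m s) ((monom 1 m - 1) ^ k)"
proof -
  have Ys: "Y ^\<^sub>m s \<in> carrier_mat n n" using Y by simp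
  have "poly_mat Y (monom 1 (s * m)) = poly_mat Y (monom 1 s ^ m)"
    by (simp add: monom_power)
  also have "\<dots> = poly_mat (Y ^\<^sub>m s) (monom 1 m)"
    using Y by (simp add: poly_mat_power[OF Y] poly_mat_monom[OF Y] poly_mat_monom[OF Ys])
  finally show ?thesis
    by (simp add: poly_mat_power[OF Y] poly_mat_power[OF Ys] poly_mat_minus[OF Y] poly_mat_minus[OF Ys]
        poly_mat_1[OF Y] poly_mat_1[OF Ys])
qed

section \<open>Finiteness of the characteristic polynomials of roots\<close>

text \<open>A new linear factor combines a shifted coefficient with \<open>a\<close> times a
  coefficient, which multiplies the bound by at most \<open>1 + R\<close>.\<close>

lemma norm_coeff_prod_linear_le:
  fixes as :: "'a::{comm_ring_1,real_normed_algebra_1} list"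
  assumes "\<And>a. a \<in> set as \<Longrightarrow> norm a \<le> R" "R \<ge> 0"
  shows "norm (coeff (\<Prod>a\<leftarrow>as. [:- a, 1:]) i) \<le> (1 + R) ^ length as"
  using assms
proof (induction as arbitrary: i)
  case Nil
  then show ?case by (simp add: coeff_1)
next
  case (Cons a as)
  let ?p = "\<Prod>a\<leftarrow>as. [:- a, 1:]"
  have IH: "norm (coeff ?p i) \<le> (1 + R) ^ length as" for i
    using Cons by simp
  have "norm (coeff (\<Prod>a\<leftarrow>a # as. [:- a, 1:]) i) =
    norm ((case i of 0 \<Rightarrow> 0 | Suc j \<Rightarrow> coeff ?p j) - a * coeff ?p i)"
    by (simp add: coeff_pCons split: nat.split)
  also have "\<dots> \<le> norm (case i of 0 \<Rightarrow> 0 | Suc j \<Rightarrow> coeff ?p j) + norm (a * coeff ?p i)"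
    by (rule norm_triangle_ineq4)
  also have "norm (case i of 0 \<Rightarrow> 0 | Suc j \<Rightarrow> coeff ?p j) \<le> (1 + R) ^ length as"
    using IH \<open>R \<ge> 0\<close> by (simp split: nat.split)
  also have "norm (a * coeff ?p i) \<le> R * (1 + R) ^ length as"
    using Cons.prems IH[of i] norm_mult_ineq[of a "coeff ?p i"]
    by (meson list.set_intros(1) mult_mono norm_ge_zero order_trans)
  finally show ?case by (simp add: algebra_simps)
qed

text \<open>Coefficients padded with zeros to length \<open>Suc n\<close> encode these polynomials
  by lists of fixed length over a finite interval.\<close>

lemma finite_bounded_int_polys:
  "finite {p :: int poly. degree p \<le> n \<and> (\<forall>i. \<bar>coeff p i\<bar> \<le> C)}"
proof (rule finite_subset)
  show "{p :: int poly. degree p \<le> n \<and> (\<forall>i. \<bar>coeff p i\<bar> \<le> C)} \<subseteq>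
    Poly ` {xs. set xs \<subseteq> {-C..C} \<and> length xs = Suc n}"
  proof safe
    fix p :: "int poly" assume p: "degree p \<le> n" "\<forall>i. \<bar>coeff p i\<bar> \<le> C"
    have "p = Poly (map (coeff p) [0..<Suc n])"
    proof (rule poly_eqI)
      fix i show "coeff p i = coeff (Poly (map (coeff p) [0..<Suc n])) i"
        using p(1) by (simp add: coeff_Poly_eq nth_default_def coeff_eq_0 del: upt_Suc)
    qed
    moreover have "map (coeff p) [0..<Suc n] \<in> {xs. set xs \<subseteq> {-C..C} \<and> length xs = Suc n}"
      using p(2) by (auto simp: abs_le_iff minus_le_iff)
    ultimately show "p \<in> Poly ` {xs. set xs \<subseteq> {-C..C} \<and> length xs = Suc n}" by blast
  qed
  show "finite (Poly ` {xs :: int list. set xs \<subseteq> {-C..C} \<and> length xs = Suc n})"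
    by (intro finite_imageI finite_lists_length_eq) auto
qed

abbreviation complex_poly :: "int poly \<Rightarrow> complex poly" where
  "complex_poly \<equiv> map_poly of_int"

lemma complex_char_poly:
  assumes "Y \<in> carrier_mat n n"
  shows "char_poly (map_mat of_int Y) = complex_poly (char_poly Y)"
  using assms by (rule of_int_hom.char_poly_hom)

lemma complex_eigenvalue_iff:
  assumes "Y \<in> carrier_mat n n"
  shows "eigenvalue (map_mat of_int Y) \<mu> \<longleftrightarrow> poly (complex_poly (char_poly Y)) \<mu> = 0"
  using assms by (subst eigenvalue_root_char_poly[of _ n]) (auto simp: complex_char_poly)

text \<open>A complex eigenvector of \<open>Y\<close> for \<open>\<mu>\<close> is one of the
  \<open>s\<close>-th power of \<open>Y\<close> for \<open>\<mu> ^ s\<close>.\<close>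

lemma root_char_poly_power:
  assumes Y: "Y \<in> carrier_mat n n" and "poly (complex_poly (char_poly Y)) \<mu> = 0"
  shows "poly (complex_poly (char_poly (Y ^\<^sub>m s))) (\<mu> ^ s) = 0"
proof -
  let ?Y = "map_mat of_int Y :: complex mat"
  have c: "?Y \<in> carrier_mat n n" using Y by simp
  obtain v where v: "eigenvector ?Y v \<mu>"
    using assms complex_eigenvalue_iff[OF Y] unfolding eigenvalue_def by blast
  then have "eigenvector (?Y ^\<^sub>m s) v (\<mu> ^ s)"
    using eigenvector_pow[OF c v, of s] c by (auto simp: eigenvector_def)
  moreover have "?Y ^\<^sub>m s = map_mat of_int (Y ^\<^sub>m s)"
    using of_int_hom.mat_hom_pow[OF Y] by metis
  ultimately show ?thesis
    using complex_eigenvalue_iff[of "Y ^\<^sub>m s" n] Y unfolding eigenvalue_def by auto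
qed

lemma char_poly_root_nonzero:
  assumes Y: "Y \<in> carrier_mat n n" and "det Y \<noteq> 0" and r: "poly (complex_poly (char_poly Y)) \<mu> = 0"
  shows "\<mu> \<noteq> 0"
proof
  assume "\<mu> = 0"
  let ?Y = "map_mat of_int Y :: complex mat"
  obtain v where "eigenvector ?Y v 0"
    using r complex_eigenvalue_iff[OF Y] \<open>\<mu> = 0\<close> unfolding eigenvalue_def by blast
  then have "v \<in> carrier_vec n \<and> v \<noteq> 0\<^sub>v n \<and> ?Y *\<^sub>v v = 0\<^sub>v n"
    using Y by (auto simp: eigenvector_def)
  then have "det ?Y = 0"
    using det_0_iff_vec_prod_zero_field[of ?Y n] Y by auto
  then show False using assms by simp
qed

lemma finite_char_poly_roots:
  assumes T: "T \<in> carrier_mat n n"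
  shows "finite {\<mu>. poly (complex_poly (char_poly T)) \<mu> = 0}"
proof -
  have "char_poly T \<noteq> 0" using degree_monic_char_poly[OF T] by auto
  then show ?thesis by (intro poly_roots_finite) auto
qed

text \<open>The eigenvalues of \<open>Y\<close> are \<open>s\<close>-th roots of those of \<open>T\<close>, which bounds them, and hence the
  coefficients of the characteristic polynomial, independently of \<open>s\<close>.\<close>
lemma finite_char_polys_of_roots:
  fixes T :: "int mat"
  assumes T: "T \<in> carrier_mat n n"
  shows "finite {char_poly Y |Y s. Y \<in> carrier_mat n n \<and> s > 0 \<and> Y ^\<^sub>m s = T}"
proof -
  \<comment> \<open>With \<open>R\<close> at least 1, a number of norm above \<open>R\<close> has
    all positive powers of norm above \<open>R\<close>; so the bound for eigenvalues of
    \<open>T\<close> also holds for those of \<open>Y\<close>.\<close>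
  obtain R where R: "R \<ge> 1" "\<And>\<mu>. poly (complex_poly (char_poly T)) \<mu> = 0 \<Longrightarrow> norm \<mu> \<le> R"
  proof -
    have "finite (norm ` {\<mu>. poly (complex_poly (char_poly T)) \<mu> = 0})"
      using finite_char_poly_roots[OF T] by simp
    then obtain R where "\<forall>x \<in> norm ` {\<mu>. poly (complex_poly (char_poly T)) \<mu> = 0}. x \<le> R"
      using finite_nat_set_iff_bounded_le  by (meson bdd_above_finite bdd_above_def)
    then show ?thesis by (intro that[of "max 1 R"]) force+
  qed
  define C where "C = \<lceil>(1 + R) ^ n\<rceil>"
  have "degree (char_poly Y) \<le> n \<and> (\<forall>i. \<bar>coeff (char_poly Y) i\<bar> \<le> C)"
    if Y: "Y \<in> carrier_mat n n" and s: "s > 0" "Y ^\<^sub>m s = T" for Y s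
  proof -
    obtain as where as: "complex_poly (char_poly Y) = (\<Prod>a\<leftarrow>as. [:- a, 1:])" "length as = n"
      using char_poly_factorized[of "map_mat of_int Y" n] Y by (auto simp: complex_char_poly)
    have a: "norm a \<le> R" if "a \<in> set as" for a
    proof (rule ccontr)
      assume "\<not> norm a \<le> R"
      have "poly (complex_poly (char_poly Y)) a = 0"
        unfolding as using that by (auto simp: poly_prod_list prod_list_zero_iff)
      from root_char_poly_power[OF Y this, of s] have "norm a ^ s \<le> R"
        using R(2) s by (auto simp flip: norm_power)
      moreover have "norm a \<le> norm a ^ s"
        using \<open>\<not> norm a \<le> R\<close> R(1) s by (intro self_le_power) auto
      ultimately show False using \<open>\<not> norm a \<le> R\<close> by linarith
    qed
    have "\<bar>coeff (char_poly Y) i\<bar> \<le> C" for i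
    proof -
      have "real_of_int \<bar>coeff (char_poly Y) i\<bar> = norm (coeff (complex_poly (char_poly Y)) i)"
        by simp
      also have "\<dots> \<le> (1 + R) ^ n"
        unfolding as(1) as(2)[symmetric] using a R(1) by (intro norm_coeff_prod_linear_le) auto
      finally show ?thesis unfolding C_def by linarith
    qed
    then show ?thesis using degree_monic_char_poly[OF Y] by auto
  qed
  then have "{char_poly Y |Y s. Y \<in> carrier_mat n n \<and> s > 0 \<and> Y ^\<^sub>m s = T} \<subseteq>
     {p. degree p \<le> n \<and> (\<forall>i. \<bar>coeff p i\<bar> \<le> C)}" by blast
  then show ?thesis by (rule finite_subset) (rule finite_bounded_int_polys)
qed

section \<open>Unipotence and roots of unity\<close>

text \<open>Over the complex numbers each of the \<open>n\<close> linear factors of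
  \<open>char_poly Y\<close> divides \<open>X ^ N - 1\<close>, so their product divides the
  \<open>n\<close>-th power; Cayley-Hamilton concludes, and the result descends to the integers by
  injectivity.\<close>

lemma poly_mat_unipotent:
  assumes Y: "Y \<in> carrier_mat n n"
    and "\<And>\<mu>. poly (complex_poly (char_poly Y)) \<mu> = 0 \<Longrightarrow> \<mu> ^ N = 1"
  shows "poly_mat Y ((monom 1 N - 1) ^ n) = 0\<^sub>m n n"
proof -
  let ?Y = "map_mat of_int Y :: complex mat"
  have cY: "?Y \<in> carrier_mat n n" using Y by simp
  obtain as where as: "complex_poly (char_poly Y) = (\<Prod>a\<leftarrow>as. [:- a, 1:])" "length as = n"
    using char_poly_factorized[of ?Y n] Y by (auto simp: complex_char_poly)
  have "a ^ N = 1" if "a \<in> set as" for a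
    using that assms(2) unfolding as by (auto simp: poly_prod_list prod_list_zero_iff)
  then have "(\<Prod>a\<leftarrow>as. [:- a, 1:]) dvd (monom 1 N - 1) ^ length as"
  proof (induction as)
    case (Cons a as)
    have "[:- a, 1:] dvd monom 1 N - 1"
      using Cons.prems by (simp add: poly_monom flip: poly_eq_0_iff_dvd)
    moreover have "(\<Prod>a\<leftarrow>as. [:- a, 1:]) dvd (monom 1 N - 1) ^ length as"
      using Cons by simp
    ultimately have "[:- a, 1:] * (\<Prod>a\<leftarrow>as. [:- a, 1:]) dvd (monom 1 N - 1) * (monom 1 N - 1) ^ length as"
      by (rule mult_dvd_mono)
    then show ?case by (simp only: list.map prod_list.Cons length_Cons power_Suc)
  qed simp
  then obtain q where q: "(monom 1 N - 1) ^ n = q * complex_poly (char_poly Y)"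
    unfolding as by (auto simp: dvd_def mult.commute)
  have "complex_poly ((monom 1 N - 1) ^ n) = (monom 1 N - 1) ^ n"
    by (simp add: hom_distribs of_int_hom.map_poly_hom_monom)
  then have "map_mat of_int (poly_mat Y ((monom 1 N - 1) ^ n)) = poly_mat ?Y (q * complex_poly (char_poly Y))"
    using poly_mat_of_int_hom[OF Y, of "(monom 1 N - 1) ^ n", where ?'a = complex] q by simp
  also have "\<dots> = poly_mat ?Y q * poly_mat ?Y (char_poly ?Y)"
    using Y by (simp add: poly_mat_mult[OF cY] complex_char_poly[OF Y])
  also have "\<dots> = 0\<^sub>m n n"
    using cY by (simp add: Cayley_Hamilton[OF cY] right_mult_zero_mat[of _ n n])
  also have "0\<^sub>m n n = (map_mat of_int (0\<^sub>m n n) :: complex mat)" by auto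
  finally show ?thesis by (rule of_int_hom.mat_hom_inj)
qed

text \<open>Applied to an eigenvector for \<open>\<mu>\<close>, the annihilating polynomial acts as
  the scalar \<open>(\<mu> ^ m - 1) ^ k\<close>, which must therefore vanish.\<close>

lemma root_of_unity_of_unipotent:
  assumes Y: "Y \<in> carrier_mat n n" and "poly_mat Y ((monom 1 m - 1) ^ k) = 0\<^sub>m n n"
    and r: "poly (complex_poly (char_poly Y)) \<mu> = 0"
  shows "\<mu> ^ m = 1"
proof -
  let ?Y = "map_mat of_int Y :: complex mat"
  have cY: "?Y \<in> carrier_mat n n" using Y by simp
  obtain v where v: "eigenvector ?Y v \<mu>"
    using r complex_eigenvalue_iff[OF Y] unfolding eigenvalue_def by blast
  have "complex_poly ((monom 1 m - 1) ^ k) = (monom 1 m - 1) ^ k"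
    by (simp add: hom_distribs of_int_hom.map_poly_hom_monom)
  then have "poly_mat ?Y ((monom 1 m - 1) ^ k) = 0\<^sub>m n n"
    using poly_mat_of_int_hom[OF Y, of "(monom 1 m - 1) ^ k", where ?'a = complex] assms(2) by auto
  moreover have "0\<^sub>m n n *\<^sub>v v = 0\<^sub>v n"
    using v Y by (intro eq_vecI) (auto simp: eigenvector_def)
  ultimately have "poly ((monom 1 m - 1) ^ k) \<mu> \<cdot>\<^sub>v v = 0\<^sub>v n"
    using poly_mat_eigenvector[OF cY v, of "(monom 1 m - 1) ^ k"] v Y
    by simp
  moreover have "v \<in> carrier_vec n" "v \<noteq> 0\<^sub>v n" using v Y by (auto simp: eigenvector_def)
  moreover from this obtain i where "i < n" "v $ i \<noteq> 0" by force
  ultimately have "poly ((monom 1 m - 1) ^ k) \<mu> = 0"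
    by (metis carrier_vecD index_smult_vec(1) index_zero_vec(1) mult_eq_0_iff)
  then show ?thesis by (auto simp: poly_monom)
qed

lemma common_root_of_unity_exponent:
  fixes E :: "'a::comm_ring_1 set"
  assumes "finite E" "\<And>\<mu>. \<mu> \<in> E \<Longrightarrow> \<exists>m>0. \<mu> ^ m = 1"
  shows "\<exists>N>0. \<forall>\<mu>\<in>E. \<mu> ^ N = 1"
  using assms
proof (induction E rule: finite_induct)
  case (insert x E)
  then obtain N where "N > 0" "\<forall>\<mu>\<in>E. \<mu> ^ N = 1" by auto
  moreover obtain m where "m > 0" "x ^ m = 1" using insert.prems by blast
  ultimately show ?case
    by (intro exI[of _ "N * m"]) (auto simp: power_mult, metis power_mult mult.commute power_one)
qed auto

section \<open>Divisible integer matrices\<close>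

text \<open>Unipotence of a power of one well-chosen root passes to \<open>T\<close> and from
  \<open>T\<close> to all other roots. As only finitely many characteristic polynomials occur,
  \<open>N\<close> can be chosen independently of \<open>s\<close>.\<close>

theorem divisible_int_mat_roots_unipotent:
  fixes T :: "int mat"
  assumes T: "T \<in> carrier_mat n n" and "det T \<noteq> 0" and S: "infinite S" "\<forall>s\<in>S. 0 < s"
    and root: "\<forall>s\<in>S. \<exists>Y\<in>carrier_mat n n. Y ^\<^sub>m s = T"
  shows "\<exists>N>0. \<forall>s\<in>S. \<forall>Y\<in>carrier_mat n n. Y ^\<^sub>m s = T \<longrightarrow>
    poly_mat Y ((monom 1 N - 1) ^ n) = 0\<^sub>m n n"
proof -
  obtain Z where Z: "Z s \<in> carrier_mat n n" "Z s ^\<^sub>m s = T" if "s \<in> S" for s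
    using root by metis
  let ?P = "{char_poly Y |Y s. Y \<in> carrier_mat n n \<and> s > 0 \<and> Y ^\<^sub>m s = T}"
  have fin: "finite ?P" by (rule finite_char_polys_of_roots[OF T])
  have "(char_poly \<circ> Z) ` S \<subseteq> ?P" using Z S(2) by fastforce
  then have "finite ((char_poly \<circ> Z) ` S)" using fin by (rule finite_subset)
  from pigeonhole_infinite[OF S(1) this] obtain t
    where t: "t \<in> S" and inf: "infinite {s\<in>S. char_poly (Z s) = char_poly (Z t)}" by auto
  let ?roots = "\<lambda>p. {\<mu>. poly (complex_poly p) \<mu> = 0}"
  have rZ: "\<exists>m>0. \<mu> ^ m = 1" if \<mu>: "\<mu> \<in> ?roots (char_poly (Z t))" for \<mu>
  proof -
    \<comment> \<open>For infinitely many \<open>s\<close> the power \<open>\<mu> ^ s\<close> lies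
      in the finite set of eigenvalues of \<open>T\<close>, so two of these powers coincide.\<close>
    have r: "\<mu> ^ s \<in> ?roots (char_poly T)" if "s \<in> S" "char_poly (Z s) = char_poly (Z t)" for s
      using root_char_poly_power[OF Z(1), of s \<mu> s] Z(2)[of s] that \<mu> by auto
    then have "(\<lambda>s. \<mu> ^ s) ` {s\<in>S. char_poly (Z s) = char_poly (Z t)} \<subseteq> ?roots (char_poly T)"
      by blast
    then have "finite ((\<lambda>s. \<mu> ^ s) ` {s\<in>S. char_poly (Z s) = char_poly (Z t)})"
      by (rule finite_subset) (rule finite_char_poly_roots[OF T])
    then have "\<not> inj_on (\<lambda>s. \<mu> ^ s) {s\<in>S. char_poly (Z s) = char_poly (Z t)}"
      using inf finite_imageD by blast
    then obtain a b where "a < b" "\<mu> ^ a = \<mu> ^ b"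
      unfolding inj_on_def by (metis nat_neq_iff)
    \<comment> \<open>Cancelling the smaller power needs \<open>\<mu>\<close> nonzero:
      \<open>\<mu> ^ t\<close> is an eigenvalue of \<open>T\<close>, whose determinant is
      nonzero.\<close>
    moreover have "\<mu> \<noteq> 0"
      using char_poly_root_nonzero[OF T assms(2), of "\<mu> ^ t"] r[OF t refl] S(2) t by auto
    moreover have "\<mu> ^ b = \<mu> ^ a * \<mu> ^ (b - a)"
      using \<open>a < b\<close> by (simp flip: power_add)
    ultimately show ?thesis
      by (intro exI[of _ "b - a"]) auto
  qed
  have "finite (?roots (char_poly (Z t)))" using Z(1)[OF t] by (rule finite_char_poly_roots)
  then obtain N0 where N0: "N0 > 0" "\<forall>\<mu> \<in> ?roots (char_poly (Z t)). \<mu> ^ N0 = 1"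
    using common_root_of_unity_exponent[OF _ rZ] by blast
  have "poly_mat (Z t) ((monom 1 N0 - 1) ^ n) = 0\<^sub>m n n"
    using N0 Z(1)[OF t] by (intro poly_mat_unipotent) auto
  \<comment> \<open>\<open>y - 1\<close> divides \<open>y ^ t - 1\<close>; with
    \<open>y = X ^ N0\<close> this turns an annihilator of \<open>Z t\<close> into one that depends
    on \<open>X ^ t\<close> only, hence into an annihilator of \<open>T\<close>.\<close>
  moreover have "\<exists>q. ((monom 1 (t * N0) - 1) ^ n :: int poly) = q * (monom 1 N0 - 1) ^ n"
    using power_minus_one_expand[of "monom 1 N0 :: int poly" t]
    by (auto simp: monom_power power_mult_distrib mult.commute)
  ultimately have "poly_mat (Z t) ((monom 1 (t * N0) - 1) ^ n) = 0\<^sub>m n n"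
    using poly_mat_mult[OF Z(1)[OF t]] Z(1)[OF t] right_mult_zero_mat poly_mat_carrier by metis
  then have TN0: "poly_mat T ((monom 1 N0 - 1) ^ n) = 0\<^sub>m n n"
    using poly_mat_power_minus_one[OF Z(1)[OF t], of t N0 n] Z(2)[OF t] by simp
  \<comment> \<open>The exponent found here, \<open>s * N0\<close>, still varies with
    \<open>s\<close>; the finiteness of all roots together then gives a common one.\<close>
  have "\<exists>m>0. \<mu> ^ m = 1" if p: "p \<in> ?P" and \<mu>: "\<mu> \<in> ?roots p" for \<mu> p
  proof -
    obtain Y s where Y: "Y \<in> carrier_mat n n" "s > 0" "Y ^\<^sub>m s = T" "p = char_poly Y"
      using p by auto
    have "\<mu> ^ (s * N0) = 1"
      using \<mu> Y TN0 poly_mat_power_minus_one[OF Y(1), of s N0 n]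
      by (intro root_of_unity_of_unipotent[OF Y(1), of _ n]) auto
    then show ?thesis using \<open>N0 > 0\<close> \<open>s > 0\<close> by (intro exI[of _ "s * N0"]) auto
  qed
  moreover have "finite (\<Union>p\<in>?P. ?roots p)"
    using fin finite_char_poly_roots by blast
  ultimately obtain N where N: "N > 0" "\<forall>\<mu>\<in>(\<Union>p\<in>?P. ?roots p). \<mu> ^ N = 1"
    using common_root_of_unity_exponent[of "\<Union>p\<in>?P. ?roots p"] by blast
  then show ?thesis
    using S(2) by (intro exI[of _ N]) (auto intro!: poly_mat_unipotent)
qed

text \<open>If the nilpotency index of \<open>T ^ N - 1\<close> exceeded 1, its last nonzero power
  would have a nonzero integer entry divisible by every \<open>s\<close> in the infinite set
  \<open>S\<close>.\<close>

theorem divisible_int_mat_roots_finite_order: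
  fixes T :: "int mat"
  assumes T: "T \<in> carrier_mat n n" and "det T \<noteq> 0" and S: "infinite S" "\<forall>s\<in>S. 0 < s"
    and root: "\<forall>s\<in>S. \<exists>Y\<in>carrier_mat n n. Y ^\<^sub>m s = T"
  shows "\<exists>N>0. \<forall>s\<in>S. \<forall>Y\<in>carrier_mat n n. Y ^\<^sub>m s = T \<longrightarrow> Y ^\<^sub>m N = 1\<^sub>m n"
proof -
  obtain N where N: "N > 0" and nil: "\<And>s Y. s \<in> S \<Longrightarrow> Y \<in> carrier_mat n n \<Longrightarrow> Y ^\<^sub>m s = T \<Longrightarrow>
    poly_mat Y ((monom 1 N - 1) ^ n) = 0\<^sub>m n n"
    using divisible_int_mat_roots_unipotent[OF assms] by blast
  let ?w = "monom 1 N - 1 :: int poly"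
  \<comment> \<open>A nilpotency exponent for \<open>T ^ N - 1\<close> also serves
    \<open>Y ^ N - 1\<close>: the annihilator of \<open>Y\<close> is closed under division by
    positive integers because the entries are integers, so the descent on exponents applies.\<close>
  have transfer: "poly_mat Y (?w ^ k) = 0\<^sub>m n n"
    if s: "s \<in> S" and Y: "Y \<in> carrier_mat n n" "Y ^\<^sub>m s = T" and k: "poly_mat T (?w ^ k) = 0\<^sub>m n n" for s Y k
  proof -
    let ?I = "{p. poly_mat Y p = 0\<^sub>m n n}"
    have "?w ^ k \<in> ?I"
    proof (rule power_mem_of_power_power_minus_one_mem[of ?I _ n s])
      show "(monom 1 N ^ s - 1) ^ k \<in> ?I"
        using poly_mat_power_minus_one[OF Y(1), of s N k] Y(2) k by (simp add: monom_power mult.commute)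
      show "?w ^ n \<in> ?I" using nil[OF s Y] by simp
      show "s > 0" using S(2) s by simp
      show "p \<in> ?I" if "m > 0" "of_nat m * p \<in> ?I" for p m
      proof -
        have *: "int m \<cdot>\<^sub>m poly_mat Y p = 0\<^sub>m n n"
          using that by (simp add: of_nat_poly poly_mat_smult)
        have "poly_mat Y p $$ (i, j) = 0" if "i < n" "j < n" for i j
          using arg_cong[OF *, of "\<lambda>A. A $$ (i, j)"] that \<open>m > 0\<close> Y(1) by simp
        then show ?thesis using Y(1) by (auto intro!: eq_matI)
      qed
    qed (use Y(1) poly_mat_carrier[OF Y(1)] in \<open>auto simp: poly_mat_mult poly_mat_minus right_mult_zero_mat[of _ n n]\<close>)
    then show ?thesis by simp
  qed
  obtain t where t: "t \<in> S" using S(1) by fastforce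
  obtain Z where Z: "Z \<in> carrier_mat n n" "Z ^\<^sub>m t = T" using root t by blast
  have "\<exists>k. poly_mat T (?w ^ k) = 0\<^sub>m n n"
  proof -
    have "poly_mat Z (?w ^ n) = 0\<^sub>m n n" using nil[OF t Z] .
    moreover have "\<exists>q. ((monom 1 (t * N) - 1) ^ n :: int poly) = q * ?w ^ n"
      using power_minus_one_expand[of "monom 1 N :: int poly" t]
      by (auto simp: monom_power power_mult_distrib mult.commute)
    ultimately have "poly_mat Z ((monom 1 (t * N) - 1) ^ n) = 0\<^sub>m n n"
      using poly_mat_mult[OF Z(1)] Z(1) right_mult_zero_mat poly_mat_carrier by metis
    then show ?thesis
      using poly_mat_power_minus_one[OF Z(1), of t N n] Z(2) by auto
  qed
  \<comment> \<open>Here \<open>k\<close> is the nilpotency index itself, one more than the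
    \<open>k\<close> of the overview; \<open>l\<close> below takes the role of the latter.\<close>
  define k where "k = (LEAST k. poly_mat T (?w ^ k) = 0\<^sub>m n n)"
  have k: "poly_mat T (?w ^ k) = 0\<^sub>m n n"
    unfolding k_def using \<open>\<exists>k. _ k\<close> by (rule LeastI_ex)
  have kmin: "poly_mat T (?w ^ j) \<noteq> 0\<^sub>m n n" if "j < k" for j
    using that unfolding k_def by (rule not_less_Least)
  have "k \<le> 1"
  proof (rule ccontr)
    assume "\<not> k \<le> 1"
    define l where "l = k - 1"
    have l: "l > 0" "k = Suc l" using \<open>\<not> k \<le> 1\<close> by (auto simp: l_def)
    have "\<exists>i<n. \<exists>j<n. poly_mat T (?w ^ l) $$ (i, j) \<noteq> 0"
    proof (rule ccontr)
      assume "\<not> ?thesis"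
      then have "poly_mat T (?w ^ l) = 0\<^sub>m n n" using T by (intro eq_matI) auto
      then show False using kmin[of l] l by simp
    qed
    then obtain i j where ij: "i < n" "j < n" "poly_mat T (?w ^ l) $$ (i, j) \<noteq> 0" by blast
    define a where "a = poly_mat T (?w ^ l) $$ (i, j)"
    have "s \<le> nat \<bar>a\<bar>" if s: "s \<in> S" for s
    proof -
      obtain Y where Y: "Y \<in> carrier_mat n n" "Y ^\<^sub>m s = T" using root s by blast
      have 0: "poly_mat Y (?w ^ Suc l) = 0\<^sub>m n n"
        using transfer[OF s Y k] l by simp
      obtain q where q: "(monom 1 N ^ s - 1) ^ l = of_nat (s ^ l) * ?w ^ l + ?w ^ Suc l * q"
        using power_power_minus_one_expand by blast
      have "poly_mat T (?w ^ l) = poly_mat Y ((monom 1 N ^ s - 1) ^ l)"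
        using poly_mat_power_minus_one[OF Y(1), of s N l] Y(2) by (simp add: monom_power mult.commute)
      \<comment> \<open>All terms of order above \<open>l\<close> in the expansion vanish by
        \<open>transfer\<close>, so only \<open>s ^ l\<close> times an integer matrix
        remains.\<close>
      also have "\<dots> = poly_mat Y (of_nat (s ^ l) * ?w ^ l) + 0\<^sub>m n n * poly_mat Y q"
        unfolding q poly_mat_add poly_mat_mult[OF Y(1), of "?w ^ Suc l"] 0 ..
      also have "\<dots> = int (s ^ l) \<cdot>\<^sub>m poly_mat Y (?w ^ l)"
        using Y(1) poly_mat_carrier[OF Y(1)]
        by (simp add: of_nat_poly poly_mat_smult left_mult_zero_mat[of _ n n] right_add_zero_mat[of _ n n])
      finally have "a = int (s ^ l) * poly_mat Y (?w ^ l) $$ (i, j)"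
        using ij Y(1) by (simp add: a_def)
      then have "int s dvd a" using \<open>l > 0\<close> by (auto intro: dvd_mult2 dvd_power)
      then show ?thesis using ij(3) dvd_imp_le_int[of a "int s"] by (simp add: a_def)
    qed
    then show False using S(1) finite_nat_set_iff_bounded_le by blast
  qed
  \<comment> \<open>Index 0 means that the identity matrix is zero, as for \<open>n = 0\<close>; the
    equation for exponent 1 then holds as well.\<close>
  moreover have "poly_mat T (?w ^ 1) = 0\<^sub>m n n" if "k = 0"
  proof -
    have "poly_mat T (?w ^ 1 * ?w ^ 0) = poly_mat T (?w ^ 1) * 0\<^sub>m n n"
      using k that by (simp only: poly_mat_mult[OF T])
    then show ?thesis using poly_mat_carrier[OF T] by (simp add: right_mult_zero_mat[of _ n n])
  qed
  ultimately have 1: "poly_mat T (?w ^ 1) = 0\<^sub>m n n"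
    using k by (cases "k = 0") (auto simp: le_Suc_eq)
  have "Y ^\<^sub>m N = 1\<^sub>m n" if s: "s \<in> S" and Y: "Y \<in> carrier_mat n n" "Y ^\<^sub>m s = T" for s Y
  proof -
    have "Y ^\<^sub>m N - 1\<^sub>m n = 0\<^sub>m n n"
      using transfer[OF s Y 1] Y(1) by (simp add: poly_mat_minus poly_mat_monom)
    then have "(Y ^\<^sub>m N - 1\<^sub>m n) $$ (i, j) = 0" if "i < n" "j < n" for i j
      using that by simp
    then show ?thesis using Y(1) by (intro eq_matI) auto
  qed
  then show ?thesis using N by blast
qed

section \<open>Algebraic integers and the trace\<close>

lemma sum_set_conv_nth:
  assumes "distinct xs"
  shows "(\<Sum>x\<in>set xs. f x) = (\<Sum>i<length xs. f (xs ! i))"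
  using assms by (intro sum.reindex_bij_betw[symmetric] bij_betw_nth) auto

lemma algebraic_int_eigenvalue:
  fixes A :: "int mat"
  assumes A: "A \<in> carrier_mat n n" and ev: "eigenvalue (map_mat of_int A) (z :: 'a::field_char_0)"
  shows "algebraic_int z"
proof -
  have "poly (char_poly (map_mat of_int A)) z = 0"
    using A ev by (subst eigenvalue_root_char_poly[symmetric, of _ n]) auto
  then have "poly (map_poly of_int (char_poly A)) z = 0"
    by (simp add: of_int_hom.char_poly_hom[OF A])
  then show ?thesis
    using degree_monic_char_poly[OF A] by (auto simp: algebraic_int_altdef_ipoly)
qed

text \<open>The numbers \<open>g i\<close>, not all zero, form an eigenvector with eigenvalue
  \<open>z\<close> of the integer matrix of the coefficients \<open>c\<close>.\<close>

lemma algebraic_int_if_finite_stable: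
  fixes z :: "'a::field_char_0"
  assumes "finite I" and "\<exists>i\<in>I. g i \<noteq> 0"
    and stable: "\<And>i. i \<in> I \<Longrightarrow> \<exists>c. z * g i = (\<Sum>j\<in>I. of_int (c j) * g j)"
  shows "algebraic_int z"
proof -
  obtain xs where xs: "set xs = I" "distinct xs"
    using finite_distinct_list[OF \<open>finite I\<close>] by blast
  define n where "n = length xs"
  obtain c where c: "\<And>i. i \<in> I \<Longrightarrow> z * g i = (\<Sum>j\<in>I. of_int (c i j) * g j)"
    using stable by metis
  define A where "A = mat n n (\<lambda>(k, l). c (xs ! k) (xs ! l))"
  have A: "A \<in> carrier_mat n n" by (simp add: A_def)
  define v where "v = vec n (\<lambda>k. g (xs ! k))"
  have sum_I: "(\<Sum>j\<in>I. f j) = (\<Sum>l=0..<n. f (xs ! l))" for f :: "_ \<Rightarrow> 'a"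
    using sum_set_conv_nth[of xs f] xs by (simp add: n_def atLeast0LessThan)
  have "eigenvector (map_mat of_int A) v z"
    unfolding eigenvector_def
  proof (intro conjI)
    show "v \<in> carrier_vec (dim_row (map_mat of_int A))" using A by (simp add: v_def)
    obtain i where "i \<in> I" "g i \<noteq> 0" using assms(2) by blast
    then obtain k where "k < n" "g (xs ! k) \<noteq> 0"
      using xs(1) unfolding n_def by (metis in_set_conv_nth)
    then show "v \<noteq> 0\<^sub>v (dim_row (map_mat of_int A))"
      using A by (auto simp: v_def dest: arg_cong[of _ _ "\<lambda>u. vec_index u k"])
    show "map_mat of_int A *\<^sub>v v = z \<cdot>\<^sub>v v"
    proof (rule eq_vecI)
      fix k assume "k < dim_vec (z \<cdot>\<^sub>v v)"
      then have k: "k < n" by (simp add: v_def)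
      then have "xs ! k \<in> I" using xs(1) by (auto simp: n_def)
      then show "(map_mat of_int A *\<^sub>v v) $ k = (z \<cdot>\<^sub>v v) $ k"
        using k c[of "xs ! k"] by (simp add: A_def v_def scalar_prod_def sum_I)
    qed (simp add: A_def v_def)
  qed
  then show ?thesis
    by (intro algebraic_int_eigenvalue[OF A]) (auto simp: eigenvalue_def)
qed

lemma algebraic_int_power_reduce:
  fixes x :: "'a::field_char_0"
  assumes "algebraic_int x"
  obtains m c where "m > 0" "x ^ m = (\<Sum>i<m. of_int (c i) * x ^ i)"
proof -
  obtain p where p: "poly (map_poly of_int p) x = 0" "lead_coeff p = 1"
    using assms by (auto simp: algebraic_int_altdef_ipoly)
  define m where "m = degree p"
  have "m > 0"
    using p by (intro Nat.gr0I) (auto simp: m_def elim!: degree_eq_zeroE)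
  have "0 = (\<Sum>i\<le>m. of_int (coeff p i) * x ^ i)"
    using p(1) by (simp add: poly_altdef degree_map_poly coeff_map_poly m_def)
  also have "\<dots> = (\<Sum>i<m. of_int (coeff p i) * x ^ i) + x ^ m"
    using p(2) by (simp add: lessThan_Suc_atMost[symmetric] m_def)
  finally have "x ^ m = - (\<Sum>i<m. of_int (coeff p i) * x ^ i)"
    by (metis eq_neg_iff_add_eq_0 add.commute)
  also have "\<dots> = (\<Sum>i<m. of_int (- coeff p i) * x ^ i)"
    by (simp add: sum_negf)
  finally have "x ^ m = (\<Sum>i<m. of_int (- coeff p i) * x ^ i)" .
  with \<open>m > 0\<close> show ?thesis by (rule that)
qed

text \<open>The monomials \<open>x ^ i * y ^ j\<close> with \<open>i < m\<close> and
  \<open>j < n\<close> have an integer span stable under multiplication by \<open>x\<close> and by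
  \<open>y\<close>, hence by \<open>x + y\<close>.\<close>

lemma algebraic_int_add:
  fixes x y :: "'a::field_char_0"
  assumes x: "algebraic_int x" and y: "algebraic_int y"
  shows "algebraic_int (x + y)"
proof -
  obtain m c where m: "m > 0" "x ^ m = (\<Sum>i<m. of_int (c i) * x ^ i)"
    using algebraic_int_power_reduce[OF x] .
  obtain n d where n: "n > 0" "y ^ n = (\<Sum>i<n. of_int (d i) * y ^ i)"
    using algebraic_int_power_reduce[OF y] .
  let ?I = "{..<m} \<times> {..<n}" and ?g = "\<lambda>(i, j). x ^ i * y ^ j"
  have delta: "(\<Sum>b<n. of_int (if b = j then k else 0) * g b) = of_int k * g j"
    if "j < n" for j n k and g :: "nat \<Rightarrow> 'a"
  proof -
    have "(\<Sum>b<n. of_int (if b = j then k else 0) * g b) = (\<Sum>b<n. if b = j then of_int k * g b else 0)"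
      by (intro sum.cong) auto
    then show ?thesis using that by simp
  qed
  \<comment> \<open>Multiplication by \<open>x\<close> shifts the exponent by one, except at the top
    exponent \<open>m - 1\<close>, where the monic relation is used.\<close>
  have mul: "\<exists>c. x * x ^ i = (\<Sum>j<m. of_int (c j) * x ^ j)"
    if "i < m" "x ^ m = (\<Sum>i<m. of_int (c i) * x ^ i)" for x :: 'a and i m c
  proof (cases "Suc i = m")
    case True
    then show ?thesis using that(2) by (intro exI[of _ c]) auto
  next
    case False
    with \<open>i < m\<close> have "Suc i < m" by simp
    from delta[OF this, of 1 "\<lambda>j. x ^ j"] show ?thesis
      by (intro exI[of _ "\<lambda>j. if j = Suc i then 1 else 0"]) (simp only: power_Suc of_int_1 mult_1_left)
  qed
  show ?thesis
  proof (rule algebraic_int_if_finite_stable[of ?I ?g])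
    show "\<exists>i\<in>?I. ?g i \<noteq> 0" using m(1) n(1) by (intro bexI[of _ "(0, 0)"]) auto
    fix k assume "k \<in> ?I"
    then obtain i j where k: "k = (i, j)" "i < m" "j < n" by auto
    obtain c' where c': "x * x ^ i = (\<Sum>a<m. of_int (c' a) * x ^ a)" using mul[OF k(2) m(2)] by blast
    obtain d' where d': "y * y ^ j = (\<Sum>b<n. of_int (d' b) * y ^ b)" using mul[OF k(3) n(2)] by blast
    \<comment> \<open>The first summand holds the coordinates of \<open>x\<close> times the monomial
      \<open>k\<close>, the second those of \<open>y\<close> times it.\<close>
    define e where "e = (\<lambda>(a, b). (if b = j then c' a else 0) + (if a = i then d' b else 0))"
    have "(\<Sum>a<m. \<Sum>b<n. of_int (if b = j then c' a else 0) * (x ^ a * y ^ b)) =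
      (\<Sum>a<m. of_int (c' a) * x ^ a) * y ^ j"
      by (simp only: delta[OF k(3)] sum_distrib_right mult.assoc)
    then have 1: "(\<Sum>a<m. \<Sum>b<n. of_int (if b = j then c' a else 0) * (x ^ a * y ^ b)) = x * x ^ i * y ^ j"
      unfolding c' .
    have "(\<Sum>b<n. \<Sum>a<m. of_int (if a = i then d' b else 0) * (x ^ a * y ^ b)) =
      (\<Sum>b<n. x ^ i * (of_int (d' b) * y ^ b))"
      by (simp only: delta[OF k(2)]) (simp only: mult.left_commute)
    then have 2: "(\<Sum>a<m. \<Sum>b<n. of_int (if a = i then d' b else 0) * (x ^ a * y ^ b)) = x ^ i * (y * y ^ j)"
      unfolding d' sum_distrib_left by (rule trans[OF sum.swap])
    have "(\<Sum>l\<in>?I. of_int (e l) * ?g l) =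
      (\<Sum>a<m. \<Sum>b<n. of_int (e (a, b)) * (x ^ a * y ^ b))"
      by (subst sum.cartesian_product) (simp add: case_prod_unfold)
    also have "\<dots> = x * x ^ i * y ^ j + x ^ i * (y * y ^ j)"
      by (simp only: e_def prod.case of_int_add distrib_right sum.distrib 1 2)
    also have "\<dots> = (x + y) * ?g k"
      unfolding k(1) prod.case by (simp only: distrib_right mult.left_commute mult.assoc)
    finally have "(x + y) * ?g k = (\<Sum>l\<in>?I. of_int (e l) * ?g l)" by (rule sym)
    then show "\<exists>c. (x + y) * ?g k = (\<Sum>l\<in>?I. of_int (c l) * ?g l)" by (intro exI[of _ e])
  qed auto
qed

lemma algebraic_int_sum_list:
  fixes xs :: "'a::field_char_0 list"
  assumes "\<And>x. x \<in> set xs \<Longrightarrow> algebraic_int x"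
  shows "algebraic_int (sum_list xs)"
  using assms by (induction xs) (auto intro: algebraic_int_add)

section \<open>Integrality of traces\<close>

lemma sum_diag_similar_mat:
  fixes A :: "'a::comm_ring_1 mat"
  assumes "similar_mat_wit A D P Q" "A \<in> carrier_mat n n"
  shows "(\<Sum>i<n. A $$ (i, i)) = (\<Sum>i<n. D $$ (i, i))"
proof -
  have comm: "(\<Sum>i<n. (B * C) $$ (i, i)) = (\<Sum>i<n. (C * B) $$ (i, i))"
    if "B \<in> carrier_mat n n" "C \<in> carrier_mat n n" for B C :: "'a mat"
  proof -
    have "(\<Sum>i<n. (B * C) $$ (i, i)) = (\<Sum>i<n. \<Sum>j<n. B $$ (i, j) * C $$ (j, i))"
      using that by (simp add: scalar_prod_def atLeast0LessThan)
    also have "\<dots> = (\<Sum>j<n. \<Sum>i<n. C $$ (j, i) * B $$ (i, j))"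
      by (subst sum.swap) (simp add: mult.commute)
    also have "\<dots> = (\<Sum>i<n. (C * B) $$ (i, i))"
      using that by (simp add: scalar_prod_def atLeast0LessThan)
    finally show ?thesis .
  qed
  note w = similar_mat_witD2[OF assms(2,1)]
  have "(\<Sum>i<n. A $$ (i, i)) = (\<Sum>i<n. (Q * (P * D)) $$ (i, i))"
    using comm[of "P * D" Q] w by simp
  also have "Q * (P * D) = D"
    using w assoc_mult_mat[of Q n n P n D n] by (simp add: left_mult_one_mat[of _ n n])
  finally show ?thesis .
qed

text \<open>A Schur decomposition gives a similar matrix with the eigenvalues on its diagonal, so
  the trace is their sum.\<close>

lemma algebraic_int_sum_diag:
  fixes A :: "complex mat"
  assumes A: "A \<in> carrier_mat n n" and "\<And>z. eigenvalue A z \<Longrightarrow> algebraic_int z"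
  shows "algebraic_int (\<Sum>i<n. A $$ (i, i))"
proof -
  obtain es where es: "char_poly A = (\<Prod>e\<leftarrow>es. [:- e, 1:])" "length es = n"
    using char_poly_factorized[OF A] by blast
  obtain D P Q where "schur_decomposition A es = (D, P, Q)" by (metis prod_cases3)
  from schur_decomposition[OF A es(1) this]
  have D: "similar_mat_wit A D P Q" "diag_mat D = es" by auto
  have "D \<in> carrier_mat n n" using similar_mat_witD2[OF A D(1)] by blast
  have "(\<Sum>i<n. A $$ (i, i)) = (\<Sum>i<n. D $$ (i, i))"
    by (rule sum_diag_similar_mat[OF D(1) A])
  also have "\<dots> = sum_list es"
    using \<open>D \<in> carrier_mat n n\<close>
    by (simp add: D(2)[symmetric] diag_mat_def atLeast0LessThan interv_sum_list_conv_sum_set_nat)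
  finally have eq: "(\<Sum>i<n. A $$ (i, i)) = sum_list es" .
  have "eigenvalue A e" if "e \<in> set es" for e
    using that by (auto simp: eigenvalue_root_char_poly[OF A] es poly_prod_list prod_list_zero_iff)
  then show ?thesis unfolding eq using assms(2) by (intro algebraic_int_sum_list) auto
qed

text \<open>An eigenvector of the transposed regular representation of \<open>x\<close>
  is a linear form \<open>\<phi>\<close> with \<open>\<phi> (x y) = z \<phi> y\<close>, so that \<open>z\<close> is a root of every rational polynomial with root \<open>x\<close>.\<close>
lemma number_field_trace:
  assumes "number_field TYPE('k::field_char_0)"
  obtains tr :: "'k::field_char_0 \<Rightarrow> rat" where
    "\<And>x y. tr (x + y) = tr x + tr y" "\<And>q x. tr (of_rat q * x) = q * tr x"
    "tr 1 \<noteq> 0" "\<And>x. algebraic_int x \<Longrightarrow> tr x \<in> \<int>"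
proof -
  obtain B where "finite_dimensional_vector_space (\<lambda>q (x::'k). of_rat q * x) B"
    using assms by (auto simp: number_field_def)
  then interpret V: finite_dimensional_vector_space "\<lambda>q (x::'k). of_rat q * x" B .
  define r where "r = V.representation B"
  note ind = V.independent_Basis
  have r_add: "r (x + y) b = r x b + r y b" and r_scale: "r (of_rat q * x) b = q * r x b" for x y q b
    by (simp_all add: r_def V.representation_add V.representation_scale ind V.span_Basis)
  have r_basis: "r b c = (if c = b then 1 else 0)" if "b \<in> B" for b c
    using that by (simp add: r_def V.representation_basis ind)
  have r_sum: "(\<Sum>b\<in>B. of_rat (r x b) * b) = x" for x
    unfolding r_def using ind V.span_Basis V.finite_Basis by (intro V.sum_representation_eq) auto
  \<comment> \<open>The trace of multiplication by \<open>x\<close>: \<open>r (x * b) b\<close> is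
    its diagonal entry at the basis vector \<open>b\<close>.\<close>
  define tr where "tr = (\<lambda>x. \<Sum>b\<in>B. r (x * b) b)"
  show ?thesis
  proof (rule that[of tr])
    show "tr (x + y) = tr x + tr y" "tr (of_rat q * x) = q * tr x" for x y q
      by (simp_all add: tr_def distrib_right r_add sum.distrib mult.assoc r_scale sum_distrib_left)
    \<comment> \<open>The trace of 1 is the degree of the field, nonzero because a basis is not
      empty.\<close>
    have "tr 1 = of_nat (card B)" by (simp add: tr_def r_basis)
    moreover have "B \<noteq> {}"
      using V.span_Basis by (metis UNIV_I V.span_empty singletonD zero_neq_one)
    ultimately show "tr 1 \<noteq> 0" using V.finite_Basis by simp
    fix x :: 'k assume "algebraic_int x"
    then obtain p where p: "poly (map_poly of_int p) x = 0" "lead_coeff p = 1"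
      by (auto simp: algebraic_int_altdef_ipoly)
    obtain bs where bs: "set bs = B" "distinct bs"
      using finite_distinct_list[OF V.finite_Basis] by blast
    define n where "n = length bs"
    have bsB: "bs ! i \<in> B" if "i < n" for i using that bs by (auto simp: n_def)
    have sum_B: "(\<Sum>b\<in>B. f b) = (\<Sum>i<n. f (bs ! i))" for f :: "_ \<Rightarrow> 'c::comm_monoid_add"
      using sum_set_conv_nth[of bs f] bs by (simp add: n_def)
    \<comment> \<open>The matrix of multiplication by \<open>x\<close>, taken over the complex
      numbers so that its trace is a sum of eigenvalues.\<close>
    define A where "A = mat n n (\<lambda>(i, j). of_rat (r (x * bs ! j) (bs ! i)) :: complex)"
    have A: "A \<in> carrier_mat n n" by (simp add: A_def)
    have "algebraic_int z" if "eigenvalue A z" for z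
    proof -
      have "eigenvalue A\<^sup>T z"
        using that A by (simp add: eigenvalue_root_char_poly[of _ n])
      then obtain w where w: "w \<in> carrier_vec n" "w \<noteq> 0\<^sub>v n" "A\<^sup>T *\<^sub>v w = z \<cdot>\<^sub>v w"
        using A by (auto simp: eigenvalue_def eigenvector_def)
      define \<phi> where "\<phi> = (\<lambda>y. \<Sum>i<n. w $ i * of_rat (r y (bs ! i)))"
      have \<phi>_add: "\<phi> (y + y') = \<phi> y + \<phi> y'" for y y'
        by (simp add: \<phi>_def r_add of_rat_add distrib_left sum.distrib)
      have \<phi>_scale: "\<phi> (of_rat q * y) = of_rat q * \<phi> y" for y q
        unfolding \<phi>_def r_scale of_rat_mult sum_distrib_left by (simp only: mult.left_commute)
      have \<phi>_0: "\<phi> 0 = 0" using \<phi>_scale[of 0 0] by simp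
      have \<phi>_sum: "\<phi> (\<Sum>i\<in>J. f i) = (\<Sum>i\<in>J. \<phi> (f i))" for J and f :: "nat \<Rightarrow> 'k"
        by (induction J rule: infinite_finite_induct) (auto simp: \<phi>_add \<phi>_0)
      have eigen: "\<phi> (x * bs ! j) = z * \<phi> (bs ! j)" if j: "j < n" for j
      proof -
        have "\<phi> (x * bs ! j) = (A\<^sup>T *\<^sub>v w) $ j"
          using j A w(1) by (simp add: \<phi>_def scalar_prod_def A_def atLeast0LessThan mult.commute)
        also have "\<dots> = z * w $ j" using j w by simp
        also have "w $ j = (\<Sum>i<n. if i = j then w $ i else 0)"
          using j by simp
        also have "\<dots> = \<phi> (bs ! j)"
          using j bs(2) unfolding \<phi>_def
          by (intro sum.cong) (auto simp: r_basis[OF bsB[OF j]] n_def nth_eq_iff_index_eq)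
        finally show ?thesis .
      qed
      have \<phi>_mult: "\<phi> (x * y) = z * \<phi> y" for y
      proof -
        define a where "a = (\<lambda>i. r y (bs ! i))"
        have y: "y = (\<Sum>i<n. of_rat (a i) * bs ! i)"
          using r_sum[of y] by (simp add: sum_B a_def)
        have "x * y = (\<Sum>i<n. of_rat (a i) * (x * bs ! i))"
          unfolding y sum_distrib_left by (simp only: mult.left_commute)
        then have "\<phi> (x * y) = (\<Sum>i<n. of_rat (a i) * \<phi> (x * bs ! i))"
          by (simp only: \<phi>_sum \<phi>_scale)
        also have "\<dots> = (\<Sum>i<n. z * (of_rat (a i) * \<phi> (bs ! i)))"
          by (intro sum.cong) (auto simp: eigen)
        also have "\<dots> = z * \<phi> y"
          unfolding y by (simp only: \<phi>_sum \<phi>_scale sum_distrib_left)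
        finally show ?thesis .
      qed
      have \<phi>_power: "\<phi> (x ^ k * y) = z ^ k * \<phi> y" for k y
        by (induction k) (simp_all add: \<phi>_mult mult.assoc)
      obtain j where j: "j < n" "w $ j \<noteq> 0" using w(1,2) by force
      have "w $ j = (\<Sum>i<n. if i = j then w $ i else 0)"
        using j by simp
      also have "\<dots> = \<phi> (bs ! j)"
        using j bs(2) unfolding \<phi>_def
        by (intro sum.cong) (auto simp: r_basis[OF bsB[OF j(1)]] n_def nth_eq_iff_index_eq)
      finally have nz: "\<phi> (bs ! j) \<noteq> 0" using j by simp
      \<comment> \<open>The form turns \<open>p x = 0\<close> into
        \<open>poly p z * \<phi> (bs ! j) = 0\<close>, and the second factor is nonzero.\<close>
      have "0 = \<phi> (poly (map_poly of_int p) x * bs ! j)" by (simp add: p(1) \<phi>_0)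
      also have "poly (map_poly of_int p) x * bs ! j =
        (\<Sum>k\<le>degree p. of_rat (of_int (coeff p k)) * (x ^ k * bs ! j))"
        by (simp add: poly_altdef degree_map_poly coeff_map_poly sum_distrib_right mult.assoc)
      also have "\<phi> \<dots> = poly (map_poly of_int p) z * \<phi> (bs ! j)"
        unfolding \<phi>_sum \<phi>_scale \<phi>_power
        by (simp add: poly_altdef degree_map_poly coeff_map_poly sum_distrib_right mult.assoc)
      finally show ?thesis using nz p(2) by (auto simp: algebraic_int_altdef_ipoly)
    qed
    then have "algebraic_int (\<Sum>i<n. A $$ (i, i))"
      by (rule algebraic_int_sum_diag[OF A])
    also have "(\<Sum>i<n. A $$ (i, i)) = of_rat (tr x)"
      by (simp add: A_def tr_def sum_B of_rat_sum)
    finally have "of_rat (tr x) \<in> (\<int> :: complex set)"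
      by (intro rational_algebraic_int_is_int) auto
    then obtain m where "of_rat (tr x) = (of_int m :: complex)" by (auto elim: Ints_cases)
    then have "tr x = of_int m" by (metis of_rat_eq_iff of_rat_of_int_eq)
    then show "tr x \<in> \<int>" by simp
  qed
qed

section \<open>Free abelian groups of finite rank\<close>

text \<open>The second clause expresses \<open>x = \<Sum>i. c\<^sub>i(x) v\<^sub>i\<close> after applying a homomorphism to \<open>\<int>\<close>, so that matrices can be
  multiplied without sums in \<open>G\<close>.\<close>
definition dual_basis :: "('a, 'b) monoid_scheme \<Rightarrow> nat \<Rightarrow> (nat \<Rightarrow> 'a) \<Rightarrow> (nat \<Rightarrow> 'a \<Rightarrow> int) \<Rightarrow> bool" where
  "dual_basis G r v c \<longleftrightarrow>
     (\<forall>i<r. v i \<in> carrier G \<and> c i \<in> hom G integer_group) \<and>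
     (\<forall>l\<in>hom G integer_group. \<forall>x\<in>carrier G. l x = (\<Sum>i<r. c i x * l (v i))) \<and>
     (\<forall>x\<in>carrier G. (\<forall>i<r. c i x = 0) \<longrightarrow> x = \<one>\<^bsub>G\<^esub>) \<and>
     (\<forall>u. \<exists>x\<in>carrier G. \<forall>i<r. c i x = u i)"

lemma hom_integer_group_apply:
  assumes "group G" "f \<in> hom G integer_group" "x \<in> carrier G"
  shows "y \<in> carrier G \<Longrightarrow> f (x \<otimes>\<^bsub>G\<^esub> y) = f x + f y" "f \<one>\<^bsub>G\<^esub> = 0"
    "f (inv\<^bsub>G\<^esub> x) = - f x" "f (x [^]\<^bsub>G\<^esub> (k::int)) = k * f x"
proof -
  interpret group_hom G integer_group f
    using assms by (simp add: group_hom_def group_hom_axioms_def)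
  show "y \<in> carrier G \<Longrightarrow> f (x \<otimes>\<^bsub>G\<^esub> y) = f x + f y" "f \<one>\<^bsub>G\<^esub> = 0"
    "f (inv\<^bsub>G\<^esub> x) = - f x"
    using assms(3) by simp_all
  show "f (x [^]\<^bsub>G\<^esub> (k::int)) = k * f x"
    using hom_int_pow[OF assms(3), of k] by simp
qed

text \<open>The smallest positive value of \<open>f\<close> generates its image: removing a suitable
  multiple of \<open>v\<close> from \<open>x\<close> leaves the remainder of \<open>f x\<close> as a
  value, which minimality forces to be 0.\<close>

lemma hom_integer_group_dvd:
  fixes G (structure)
  assumes "group G" "f \<in> hom G integer_group" "\<exists>x\<in>carrier G. f x \<noteq> 0"
  obtains v where "v \<in> carrier G" "f v > 0" "\<And>x. x \<in> carrier G \<Longrightarrow> f v dvd f x"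
proof -
  interpret group G by fact
  note f = hom_integer_group_apply[OF assms(1,2)]
  let ?P = "\<lambda>n. n > 0 \<and> (\<exists>x\<in>carrier G. f x = int n)"
  obtain x where x: "x \<in> carrier G" "f x \<noteq> 0" using assms(3) by blast
  have "?P (nat \<bar>f x\<bar>)"
  proof (cases "f x > 0")
    case True
    then show ?thesis using x(1) by (intro conjI bexI[of _ x]) auto
  next
    case False
    then show ?thesis using x f(3)[OF x(1)] by (intro conjI bexI[of _ "inv x"]) auto
  qed
  then have P: "?P (LEAST n. ?P n)" by (rule LeastI)
  define g where "g = (LEAST n. ?P n)"
  obtain v where v: "v \<in> carrier G" "f v = int g" "g > 0" using P unfolding g_def by blast
  show ?thesis
  proof (rule that[of v])
    fix x assume x: "x \<in> carrier G"
    have "f (x \<otimes> inv (v [^] (f x div f v))) = f x mod f v"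
      using x v(1) by (simp add: f minus_div_mult_eq_mod)
    moreover have mod: "f x mod f v \<ge> 0" "f x mod f v < int g" using v by auto
    moreover have "x \<otimes> inv (v [^] (f x div f v)) \<in> carrier G" using x v by simp
    ultimately have "\<exists>y\<in>carrier G. f y = int (nat (f x mod f v))" by auto
    moreover have "\<not> ?P (nat (f x mod f v))"
      using mod unfolding g_def by (intro not_less_Least) (auto simp: nat_less_iff)
    ultimately have "f x mod f v = 0" using mod by simp
    then show "f v dvd f x" by (simp add: dvd_eq_mod_eq_0)
  qed (use v in auto)
qed

text \<open>Since \<open>f w\<close> generates the image of \<open>f\<close>, the group splits into
  the kernel of \<open>f\<close> and the infinite cyclic group of \<open>w\<close>; the new basis
  element is \<open>w\<close>.\<close>

lemma dual_basis_extend: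
  fixes G (structure)
  assumes "comm_group G" and f: "f \<in> hom G integer_group"
    and w: "w \<in> carrier G" "f w > 0" "\<And>x. x \<in> carrier G \<Longrightarrow> f w dvd f x"
    and vc: "dual_basis (G\<lparr>carrier := kernel G integer_group f\<rparr>) r v c"
  shows "\<exists>v c. dual_basis G (Suc r) v c"
proof -
  interpret comm_group G by fact
  define H where "H = G\<lparr>carrier := kernel G integer_group f\<rparr>"
  have H: "carrier H = {x \<in> carrier G. f x = 0}" "x \<otimes>\<^bsub>H\<^esub> y = x \<otimes> y" "\<one>\<^bsub>H\<^esub> = \<one>" for x y
    by (auto simp: H_def kernel_def)
  have hom_H: "l \<in> hom H integer_group" if "l \<in> hom G integer_group" for l
    using that by (auto simp: hom_def H)
  have v: "v i \<in> carrier G" and c: "c i \<in> hom H integer_group" if "i < r" for i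
    using vc that by (auto simp: dual_basis_def H H_def[symmetric])
  have lin: "l x = (\<Sum>i<r. c i x * l (v i))" if "l \<in> hom H integer_group" "x \<in> carrier H" for l x
    using vc that unfolding dual_basis_def H_def by blast
  have inj: "x = \<one>" if "x \<in> carrier H" "\<forall>i<r. c i x = 0" for x
    using vc that unfolding dual_basis_def H_def[symmetric] H(3) by blast
  have sur: "\<exists>x\<in>carrier H. \<forall>i<r. c i x = u i" for u
    using vc unfolding dual_basis_def H_def by blast
  \<comment> \<open>\<open>t\<close> and \<open>\<pi>\<close> are the projections onto the powers of
    \<open>w\<close> and onto the kernel. Integer division is exact and additive here because
    \<open>f w\<close> divides every value of \<open>f\<close>.\<close>
  define t where "t = (\<lambda>x. w [^] (f x div f w))"
  define \<pi> where "\<pi> = (\<lambda>x. x \<otimes> inv t x)"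
  have t: "t x \<in> carrier G" for x using w(1) by (simp add: t_def)
  have l_t: "l (t x) = (f x div f w) * l w" if "l \<in> hom G integer_group" for l x
    unfolding t_def by (rule hom_integer_group_apply(4)[OF is_group that w(1)])
  have l_\<pi>: "l (\<pi> x) = l x - (f x div f w) * l w" if "l \<in> hom G integer_group" "x \<in> carrier G" for l x
    using hom_integer_group_apply(1)[OF is_group that, of "inv t x"] t[of x] l_t[OF that(1)]
      hom_integer_group_apply(3)[OF is_group that(1) t]
    by (simp add: \<pi>_def)
  have \<pi>_H: "\<pi> x \<in> carrier H" if "x \<in> carrier G" for x
    using l_\<pi>[OF f that] w(3)[OF that] that t[of x] by (simp add: H) (simp add: \<pi>_def)
  have f_div: "f (x \<otimes> y) div f w = f x div f w + f y div f w" if "x \<in> carrier G" "y \<in> carrier G" for x y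
    using hom_integer_group_apply(1)[OF is_group f that] w(3)[OF that(1)] by (simp add: div_plus_div_distrib_dvd_left)
  have t_mult: "t (x \<otimes> y) = t x \<otimes> t y" if "x \<in> carrier G" "y \<in> carrier G" for x y
    unfolding t_def f_div[OF that] using w(1) by (rule int_pow_mult)
  have \<pi>_mult: "\<pi> (x \<otimes> y) = \<pi> x \<otimes> \<pi> y" if "x \<in> carrier G" "y \<in> carrier G" for x y
  proof -
    have "inv t (x \<otimes> y) = inv t x \<otimes> inv t y"
      unfolding t_mult[OF that] by (rule inv_mult[OF t t])
    then show ?thesis
      unfolding \<pi>_def using that t[of x] t[of y] by (simp add: m_ac)
  qed
  define v' where "v' = v(r := w)"
  define c' where "c' = (\<lambda>i x. if i = r then f x div f w else c i (\<pi> x))"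
  have "dual_basis G (Suc r) v' c'"
    unfolding dual_basis_def
  proof (intro conjI allI impI ballI)
    fix i assume i: "i < Suc r"
    then show "v' i \<in> carrier G" using v w(1) by (auto simp: v'_def less_Suc_eq)
    show "c' i \<in> hom G integer_group"
    proof (rule homI)
      fix x y assume xy: "x \<in> carrier G" "y \<in> carrier G"
      have "c i (\<pi> x \<otimes> \<pi> y) = c i (\<pi> x) + c i (\<pi> y)" if "i < r"
        using hom_mult[OF c[OF that] \<pi>_H[OF xy(1)] \<pi>_H[OF xy(2)]] by (simp add: H)
      then show "c' i (x \<otimes> y) = c' i x \<otimes>\<^bsub>integer_group\<^esub> c' i y"
        using i f_div[OF xy] \<pi>_mult[OF xy] by (auto simp: c'_def less_Suc_eq)
    qed simp
  next
    fix l x assume l: "l \<in> hom G integer_group" and x: "x \<in> carrier G"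
    have "(\<Sum>i<r. c' i x * l (v' i)) = (\<Sum>i<r. c i (\<pi> x) * l (v i))"
      by (intro sum.cong) (auto simp: c'_def v'_def)
    also have "\<dots> = l (\<pi> x)"
      by (rule lin[OF hom_H[OF l] \<pi>_H[OF x], symmetric])
    finally show "l x = (\<Sum>i<Suc r. c' i x * l (v' i))"
      using l_\<pi>[OF l x] by (simp add: c'_def v'_def)
  next
    fix x assume x: "x \<in> carrier G" and 0: "\<forall>i<Suc r. c' i x = 0"
    have fx: "f x div f w = 0" using spec[OF 0, of r] by (simp add: c'_def)
    have "c i (\<pi> x) = 0" if "i < r" for i using spec[OF 0, of i] that by (simp add: c'_def)
    then have "\<pi> x = \<one>" using inj[OF \<pi>_H[OF x]] by blast
    then show "x = \<one>" using x by (simp add: \<pi>_def t_def fx)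
  next
    fix u :: "nat \<Rightarrow> int"
    obtain y where y: "y \<in> carrier H" "\<forall>i<r. c i y = u i" using sur by blast
    have yG: "y \<in> carrier G" "f y = 0" using y(1) by (auto simp: H)
    define x where "x = y \<otimes> w [^] u r"
    have "f x = u r * f w"
      using hom_integer_group_apply(1)[OF is_group f yG(1), of "w [^] u r"]
        hom_integer_group_apply(4)[OF is_group f w(1)] w(1) yG(2) by (simp add: x_def)
    then have fx: "f x div f w = u r" using w(2) by simp
    then have "\<pi> x = y" using yG(1) w(1) by (simp add: \<pi>_def t_def x_def m_assoc)
    then have "\<forall>i<Suc r. c' i x = u i"
      using y(2) fx by (auto simp: c'_def less_Suc_eq)
    moreover have "x \<in> carrier G" using yG(1) w(1) by (simp add: x_def)
    ultimately show "\<exists>x\<in>carrier G. \<forall>i<Suc r. c' i x = u i" by blast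
  qed
  then show ?thesis by blast
qed

text \<open>\<open>F\<close> embeds \<open>G\<close> into a power of \<open>\<int>\<close>.
  Induction on \<open>F\<close>: the remaining members still separate points on the kernel of
  \<open>f\<close>, and a nonzero \<open>f\<close> adds one basis element.\<close>

lemma exists_dual_basis:
  assumes "finite F" "comm_group G" "F \<subseteq> hom G integer_group"
    and "\<And>x. x \<in> carrier G \<Longrightarrow> \<forall>f\<in>F. f x = 0 \<Longrightarrow> x = \<one>\<^bsub>G\<^esub>"
  shows "\<exists>r v c. dual_basis G r v c"
  using assms
proof (induction F arbitrary: G rule: finite_induct)
  case empty
  interpret comm_group G by fact
  have "carrier G = {\<one>\<^bsub>G\<^esub>}" using empty by auto
  moreover have "l \<one>\<^bsub>G\<^esub> = 0" if "l \<in> hom G integer_group" for l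
    using hom_integer_group_apply(2)[OF is_group that one_closed] .
  ultimately have "dual_basis G 0 v c" for v c by (simp add: dual_basis_def)
  then show ?case by blast
next
  case (insert f F)
  interpret comm_group G by fact
  have f: "f \<in> hom G integer_group" and F: "F \<subseteq> hom G integer_group" using insert.prems by auto
  show ?case
  proof (cases "\<exists>x\<in>carrier G. f x \<noteq> 0")
    case False
    show ?thesis
    proof (rule insert.IH[OF \<open>comm_group G\<close> F])
      fix x assume "x \<in> carrier G" "\<forall>f\<in>F. f x = 0"
      then show "x = \<one>\<^bsub>G\<^esub>" using False by (intro insert.prems(3)) auto
    qed
  next
    case True
    obtain w where w: "w \<in> carrier G" "f w > 0" "\<And>x. x \<in> carrier G \<Longrightarrow> f w dvd f x"
      using hom_integer_group_dvd[OF is_group f True] by blast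
    define H where "H = G\<lparr>carrier := kernel G integer_group f\<rparr>"
    have H: "carrier H = {x \<in> carrier G. f x = 0}" "x \<otimes>\<^bsub>H\<^esub> y = x \<otimes>\<^bsub>G\<^esub> y" "\<one>\<^bsub>H\<^esub> = \<one>\<^bsub>G\<^esub>" for x y
      by (auto simp: H_def kernel_def)
    have "group_hom G integer_group f"
      using f by (simp add: group_hom_def group_hom_axioms_def)
    then have "subgroup (kernel G integer_group f) G" by (rule group_hom.subgroup_kernel)
    then have "group H" unfolding H_def by (rule subgroup.subgroup_is_group[OF _ is_group])
    then have "comm_group H"
      by (rule group.group_comm_groupI) (use m_comm in \<open>simp add: H\<close>)
    have "\<exists>r v c. dual_basis H r v c"
    proof (rule insert.IH[OF \<open>comm_group H\<close>])
      show "F \<subseteq> hom H integer_group" using F by (auto simp: hom_def H)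
      fix x assume "x \<in> carrier H" "\<forall>f\<in>F. f x = 0"
      then have "x = \<one>\<^bsub>G\<^esub>" by (intro insert.prems(3)) (auto simp: H)
      then show "x = \<one>\<^bsub>H\<^esub>" by (simp add: H)
    qed
    then obtain r v c where "dual_basis H r v c" by blast
    then show ?thesis
      using dual_basis_extend[OF \<open>comm_group G\<close> f w] unfolding H_def by blast
  qed
qed

section \<open>Integer matrices of endomorphisms\<close>

definition matrix_of :: "nat \<Rightarrow> (nat \<Rightarrow> 'a) \<Rightarrow> (nat \<Rightarrow> 'a \<Rightarrow> int) \<Rightarrow> ('a \<Rightarrow> 'a) \<Rightarrow> int mat" where
  "matrix_of r v c f = mat r r (\<lambda>(i, j). c i (f (v j)))"

lemma matrix_of_carrier [simp]:
  "matrix_of r v c f \<in> carrier_mat r r" "dim_row (matrix_of r v c f) = r" "dim_col (matrix_of r v c f) = r"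
  by (simp_all add: matrix_of_def)

lemma dual_basisD:
  assumes "dual_basis G r v c"
  shows "i < r \<Longrightarrow> v i \<in> carrier G" "i < r \<Longrightarrow> c i \<in> hom G integer_group"
    "l \<in> hom G integer_group \<Longrightarrow> x \<in> carrier G \<Longrightarrow> l x = (\<Sum>i<r. c i x * l (v i))"
    "x \<in> carrier G \<Longrightarrow> \<forall>i<r. c i x = 0 \<Longrightarrow> x = \<one>\<^bsub>G\<^esub>"
    "\<exists>x\<in>carrier G. \<forall>i<r. c i x = u i"
  using assms unfolding dual_basis_def by blast+

text \<open>Take \<open>x\<close> with the coordinates of the \<open>j\<close>-th unit vector;
  expanding \<open>c i\<close> at \<open>x\<close> leaves only \<open>c i (v j)\<close>.\<close>

lemma dual_basis_delta:
  assumes "dual_basis G r v c" "i < r" "j < r"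
  shows "c i (v j) = (if i = j then 1 else 0)"
proof -
  obtain x where x: "x \<in> carrier G" "\<forall>k<r. c k x = (if k = j then 1 else 0)"
    using dual_basisD(5)[OF assms(1), of "\<lambda>k. if k = j then 1 else 0"] by blast
  have "c i x = (\<Sum>k<r. c k x * c i (v k))"
    by (rule dual_basisD(3)[OF assms(1) dual_basisD(2)[OF assms(1,2)] x(1)])
  also have "\<dots> = (\<Sum>k<r. if k = j then c i (v k) else 0)"
    using x(2) by (intro sum.cong) auto
  also have "\<dots> = c i (v j)" using assms(3) by simp
  finally show ?thesis using x(2) assms(2) by auto
qed

text \<open>Composing \<open>c i\<close> with \<open>f\<close> gives another homomorphism to
  \<open>\<int>\<close>, so it expands over the basis.\<close>

lemma dual_basis_hom_apply:
  assumes b: "dual_basis G r v c" and f: "f \<in> hom G G" and x: "x \<in> carrier G" and i: "i < r"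
  shows "c i (f x) = (\<Sum>k<r. c k x * c i (f (v k)))"
proof -
  have "(\<lambda>x. c i (f x)) \<in> hom G integer_group"
    using f dual_basisD(2)[OF b i] by (auto simp: hom_def Pi_iff)
  from dual_basisD(3)[OF b this x] show ?thesis .
qed

lemma matrix_of_mult:
  assumes b: "dual_basis G r v c" and f: "f \<in> hom G G" and g: "g \<in> hom G G"
    and fg: "\<And>x. x \<in> carrier G \<Longrightarrow> k x = f (g x)"
  shows "matrix_of r v c k = matrix_of r v c f * matrix_of r v c g"
proof (rule eq_matI)
  fix i j assume "i < dim_row (matrix_of r v c f * matrix_of r v c g)" "j < dim_col (matrix_of r v c f * matrix_of r v c g)"
  then have ij: "i < r" "j < r" by (auto simp: matrix_of_def)
  have v: "v j \<in> carrier G" "g (v j) \<in> carrier G"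
    using dual_basisD(1)[OF b ij(2)] g by (auto simp: hom_def)
  show "matrix_of r v c k $$ (i, j) = (matrix_of r v c f * matrix_of r v c g) $$ (i, j)"
    using ij dual_basis_hom_apply[OF b f v(2) ij(1)]
    by (simp add: matrix_of_def fg[OF v(1)] scalar_prod_def atLeast0LessThan mult.commute)
qed (auto simp: matrix_of_def)

lemma matrix_of_one:
  assumes b: "dual_basis G r v c" and "\<And>x. x \<in> carrier G \<Longrightarrow> f x = x"
  shows "matrix_of r v c f = 1\<^sub>m r"
  using dual_basis_delta[OF b] dual_basisD(1)[OF b] assms(2) by (intro eq_matI) (auto simp: matrix_of_def)

lemma matrix_of_inj:
  assumes "group G" and b: "dual_basis G r v c" and f: "f \<in> hom G G" and g: "g \<in> hom G G"
    and eq: "matrix_of r v c f = matrix_of r v c g" and x: "x \<in> carrier G"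
  shows "f x = g x"
proof -
  interpret group G by fact
  have fg: "f x \<in> carrier G" "g x \<in> carrier G" using f g x by (auto simp: hom_def)
  have "c i (f (v k)) = c i (g (v k))" if "i < r" "k < r" for i k
    using arg_cong[OF eq, of "\<lambda>A. A $$ (i, k)"] that by (simp add: matrix_of_def)
  then have "c i (f x) = c i (g x)" if "i < r" for i
    using dual_basis_hom_apply[OF b f x that] dual_basis_hom_apply[OF b g x that] that by simp
  then have "c i (f x \<otimes>\<^bsub>G\<^esub> inv\<^bsub>G\<^esub> g x) = 0" if "i < r" for i
    using hom_integer_group_apply(1,3)[OF is_group dual_basisD(2)[OF b that]] fg that by simp
  then have "f x \<otimes>\<^bsub>G\<^esub> inv\<^bsub>G\<^esub> g x = \<one>\<^bsub>G\<^esub>"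
    using dual_basisD(4)[OF b, of "f x \<otimes>\<^bsub>G\<^esub> inv\<^bsub>G\<^esub> g x"] fg by simp
  then show ?thesis using fg by (metis inv_equality inv_inv inv_closed)
qed

text \<open>A zero determinant gives a nonzero integer kernel vector. It is the coordinate vector of
  some \<open>x\<close>, which \<open>f\<close> sends to the neutral element, against
  injectivity.\<close>

lemma det_matrix_of_nonzero:
  assumes "group G" and b: "dual_basis G r v c" and f: "f \<in> hom G G" and inj: "inj_on f (carrier G)"
  shows "det (matrix_of r v c f) \<noteq> 0"
proof
  interpret group G by fact
  assume "det (matrix_of r v c f) = 0"
  then obtain u where u: "u \<in> carrier_vec r" "u \<noteq> 0\<^sub>v r" "matrix_of r v c f *\<^sub>v u = 0\<^sub>v r"
    using det_0_iff_vec_prod_zero[OF matrix_of_carrier(1)] by blast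
  obtain x where x: "x \<in> carrier G" "\<forall>i<r. c i x = vec_index u i"
    using dual_basisD(5)[OF b, of "vec_index u"] by blast
  have fx: "f x \<in> carrier G" using f x by (auto simp: hom_def)
  have "c i (f x) = 0" if "i < r" for i
  proof -
    have "c i (f x) = vec_index (matrix_of r v c f *\<^sub>v u) i"
      using dual_basis_hom_apply[OF b f x(1) that] x(2) that u(1)
      by (simp add: matrix_of_def scalar_prod_def atLeast0LessThan mult.commute)
    then show ?thesis using u(3) that by simp
  qed
  then have "f x = \<one>\<^bsub>G\<^esub>" using dual_basisD(4)[OF b fx] by blast
  also have "\<one>\<^bsub>G\<^esub> = f \<one>\<^bsub>G\<^esub>" using hom_one[OF f is_group is_group] by simp
  finally have "x = \<one>\<^bsub>G\<^esub>" using inj x(1) by (auto dest: inj_onD)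
  then have "vec_index u i = 0" if "i < r" for i
    using x(2) that hom_integer_group_apply(2)[OF is_group dual_basisD(2)[OF b that] one_closed] by auto
  then have "u = 0\<^sub>v r" using u(1) by (intro eq_vecI) auto
  with u(2) show False by simp
qed

section \<open>Modules over rings of integers\<close>

lemma algebraic_int_mult:
  assumes "cring (ring_of_integers :: 'k::field_char_0 ring)" "algebraic_int (x :: 'k)" "algebraic_int y"
  shows "algebraic_int (x * y)"
proof -
  interpret cring "ring_of_integers :: 'k ring" by fact
  show ?thesis using m_closed[of x y] assms(2,3) by (simp add: ring_of_integers_def)
qed

lemma algebraic_int_poly:
  assumes "cring (ring_of_integers :: 'k::field_char_0 ring)" "algebraic_int (x :: 'k)"
  shows "algebraic_int (poly (map_poly of_int p) x)"
proof (induction p)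
  case (pCons a p)
  have "algebraic_int (of_int a :: 'k)" by (intro int_imp_algebraic_int) auto
  then have "algebraic_int (of_int a + x * poly (map_poly of_int p) x)"
    using assms(2) pCons.IH by (intro algebraic_int_add algebraic_int_mult[OF assms(1)])
  then show ?case by (simp add: of_int_hom.map_poly_pCons_hom)
qed simp

text \<open>Dividing \<open>p\<close> by \<open>X\<close> until the constant term is nonzero keeps
  \<open>x\<close> a root. Thus a nonzero integer is a multiple of \<open>x\<close> in
  \<open>\<int>[x]\<close>.\<close>

lemma nonzero_root_poly_coeff_0:
  assumes "p \<noteq> 0" "poly (map_poly of_int p) (x :: 'k::field_char_0) = 0" "x \<noteq> 0"
  shows "\<exists>a q. a \<noteq> 0 \<and> of_int a + x * poly (map_poly of_int q) x = 0"
  using assms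
proof (induction p)
  case (pCons a p)
  show ?case
  proof (cases "a = 0")
    case True
    then show ?thesis using pCons by (auto simp: of_int_hom.map_poly_pCons_hom)
  next
    case False
    then show ?thesis using pCons.prems
      by (intro exI[of _ a] exI[of _ p]) (simp add: of_int_hom.map_poly_pCons_hom)
  qed
qed simp

text \<open>The maps are \<open>x \<mapsto> tr (x * b)\<close> for finitely many algebraic integers
  \<open>b\<close>; they separate points because the trace form is nondegenerate.\<close>

lemma ring_of_integers_separating_homs:
  assumes nf: "number_field TYPE('k::field_char_0)" and cr: "cring (ring_of_integers :: 'k ring)"
  obtains L :: "('k::field_char_0 \<Rightarrow> int) set" where "finite L"
    "\<And>l x y. l \<in> L \<Longrightarrow> algebraic_int x \<Longrightarrow> algebraic_int y \<Longrightarrow> l (x + y) = l x + l y"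
    "\<And>x. algebraic_int x \<Longrightarrow> \<forall>l\<in>L. l x = 0 \<Longrightarrow> x = 0"
proof -
  obtain tr :: "'k \<Rightarrow> rat" where tr_add: "\<And>x y. tr (x + y) = tr x + tr y"
    and tr_scale: "\<And>q x. tr (of_rat q * x) = q * tr x"
    and tr_1: "tr 1 \<noteq> 0" and tr_int: "\<And>x. algebraic_int x \<Longrightarrow> tr x \<in> \<int>"
    using number_field_trace[OF nf] by metis
  obtain C where "finite_dimensional_vector_space (\<lambda>q (x::'k). of_rat q * x) C"
    using nf by (auto simp: number_field_def)
  then interpret V: finite_dimensional_vector_space "\<lambda>q (x::'k). of_rat q * x" C .
  \<comment> \<open>Elements of \<open>B\<close> are algebraic integers, so the traces
    \<open>tr (x * b)\<close> are integers and the floor below only changes their type; independence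
    makes \<open>B\<close> finite.\<close>
  obtain B where B: "B \<subseteq> {x :: 'k. algebraic_int x}" "V.independent B" "{x. algebraic_int x} \<subseteq> V.span B"
    using V.maximal_independent_subset[of "{x :: 'k. algebraic_int x}"] by blast
  define L where "L = (\<lambda>b x. \<lfloor>tr (x * b)\<rfloor>) ` B"
  have floor: "of_int \<lfloor>tr (x * b)\<rfloor> = tr (x * b)" if "algebraic_int x" "b \<in> B" for x b
    using tr_int[OF algebraic_int_mult[OF cr that(1), of b]] that B(1) by (auto elim!: Ints_cases)
  show ?thesis
  proof (rule that[of L])
    show "finite L" unfolding L_def using V.finiteI_independent[OF B(2)] by blast
    fix l and x y :: 'k assume l: "l \<in> L" and xy: "algebraic_int x" "algebraic_int y"
    obtain b where b: "b \<in> B" "l = (\<lambda>x. \<lfloor>tr (x * b)\<rfloor>)" using l by (auto simp: L_def)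
    have "of_int (l (x + y)) = (of_int (l x + l y) :: rat)"
      unfolding b(2) of_int_add floor[OF algebraic_int_add[OF xy] b(1)] floor[OF xy(1) b(1)] floor[OF xy(2) b(1)]
      by (simp add: distrib_right tr_add)
    then show "l (x + y) = l x + l y" by (simp only: of_int_eq_iff)
  next
    fix x :: 'k assume x: "algebraic_int x" and 0: "\<forall>l\<in>L. l x = 0"
    have trB: "tr (x * b) = 0" if "b \<in> B" for b
      using floor[OF x that] 0 that by (auto simp: L_def)
    have tr_scale': "tr (x * (of_rat q * y)) = q * tr (x * y)" for q y
      using tr_scale[of q "x * y"] by (simp add: mult.left_commute)
    \<comment> \<open>The kernel of \<open>y \<mapsto> tr (x * y)\<close> is a subspace containing
      \<open>B\<close>, hence all algebraic integers.\<close>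
    have "V.subspace {y. tr (x * y) = 0}"
    proof (rule V.subspaceI)
      show "0 \<in> {y. tr (x * y) = 0}" using tr_scale[of 0 0] by simp
    qed (auto simp: distrib_left tr_add tr_scale')
    from V.span_minimal[OF _ this, of B] have "V.span B \<subseteq> {y. tr (x * y) = 0}"
      using trB by blast
    then have tr_0: "tr (x * y) = 0" if "algebraic_int y" for y
      using that B(3) by blast
    show "x = 0"
    proof (rule ccontr)
      assume "x \<noteq> 0"
      obtain p where "poly (map_poly of_int p) x = 0" "lead_coeff p = 1"
        using x by (auto simp: algebraic_int_altdef_ipoly)
      then obtain a q where a: "a \<noteq> 0" "of_int a + x * poly (map_poly of_int q) x = 0"
        using nonzero_root_poly_coeff_0[of p x] \<open>x \<noteq> 0\<close> by (metis leading_coeff_0_iff zero_neq_one)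
      \<comment> \<open>If \<open>x\<close> were nonzero, the nonzero integer \<open>a\<close> would
        be a multiple of \<open>x\<close> by an algebraic integer and so have trace 0, although its
        trace is \<open>a * tr 1\<close>.\<close>
      have "0 = tr (of_rat 0 * 1)" unfolding tr_scale by simp
      also have "\<dots> = tr (of_rat (of_int a) * 1 + x * poly (map_poly of_int q) x)"
        using a(2) by simp
      also have "\<dots> = of_int a * tr 1"
        unfolding tr_add tr_scale using tr_0[OF algebraic_int_poly[OF cr x]] by simp
      finally show False using a(1) tr_1 by simp
    qed
  qed
qed

section \<open>Projective modules as free abelian groups\<close>

lemma carrier_ring_of_integers [simp]: "carrier ring_of_integers = {x. algebraic_int x}"
  and mult_ring_of_integers [simp]: "x \<otimes>\<^bsub>ring_of_integers\<^esub> y = x * y"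
  and add_ring_of_integers [simp]: "x \<oplus>\<^bsub>ring_of_integers\<^esub> y = x + y"
  and zero_ring_of_integers [simp]: "\<zero>\<^bsub>ring_of_integers\<^esub> = 0"
  by (simp_all add: ring_of_integers_def)

lemma free_module_simps:
  "carrier (free_module R I) = {f. (\<forall>i. f i \<in> carrier R) \<and> {i. f i \<noteq> \<zero>\<^bsub>R\<^esub>} \<subseteq> I \<and> finite {i. f i \<noteq> \<zero>\<^bsub>R\<^esub>}}"
  "(f \<oplus>\<^bsub>free_module R I\<^esub> g) i = f i \<oplus>\<^bsub>R\<^esub> g i"
  "(a \<odot>\<^bsub>free_module R I\<^esub> f) i = a \<otimes>\<^bsub>R\<^esub> f i"
  "\<zero>\<^bsub>free_module R I\<^esub> = (\<lambda>i. \<zero>\<^bsub>R\<^esub>)"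
  by (simp_all add: free_module_def)

text \<open>Projectivity embeds \<open>M\<close> into a free module and finite generation leaves
  finitely many coordinates; these, followed by the separating maps of the ring of integers,
  separate the points of \<open>M\<close>.\<close>

lemma projective_module_dual_basis:
  fixes M :: "('k::field_char_0, 'm, 'x) module_scheme"
  assumes nf: "number_field TYPE('k)" and "module ring_of_integers M"
    and fg: "finitely_generated ring_of_integers M" and "projective_module ring_of_integers M"
  shows "\<exists>r v c. dual_basis (add_monoid M) r v c"
proof -
  interpret module ring_of_integers M by fact
  let ?F = "\<lambda>I. free_module (ring_of_integers :: 'k ring) (I :: 'm set)"
  obtain I P h where P: "Module.submodule P ring_of_integers (?F I)"
    and h: "h \<in> Defs.module_hom ring_of_integers M ((?F I)\<lparr>carrier := P\<rparr>)" and bij: "bij_betw h (carrier M) P"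
    using assms(4) unfolding projective_module_def by blast
  have "P \<subseteq> carrier (?F I)" using subgroup.subset[of P "add_monoid (?F I)"] P by (simp add: Module.submodule_def)
  then have h_F: "h x \<in> carrier (?F I)" if "x \<in> carrier M" for x
    using that bij by (auto simp: bij_betw_def)
  have h_add: "h (x \<oplus>\<^bsub>M\<^esub> y) i = h x i + h y i" if "x \<in> carrier M" "y \<in> carrier M" for x y i
    using h that by (auto simp: Defs.module_hom_def hom_def free_module_simps)
  have h_smult: "h (a \<odot>\<^bsub>M\<^esub> x) i = a * h x i" if "algebraic_int a" "x \<in> carrier M" for a x i
    using h that by (auto simp: Defs.module_hom_def free_module_simps)
  have h_int: "algebraic_int (h x i)" and h_fin: "finite {i. h x i \<noteq> 0}" if "x \<in> carrier M" for x i
    using h_F[OF that] by (auto simp: free_module_simps)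
  have h_0: "h \<zero>\<^bsub>M\<^esub> i = 0" for i
    using h_add[of "\<zero>\<^bsub>M\<^esub>" "\<zero>\<^bsub>M\<^esub>" i] by simp
  have h_inv: "h (\<ominus>\<^bsub>M\<^esub> x) i = - h x i" if "x \<in> carrier M" for x i
    using h_add[of "\<ominus>\<^bsub>M\<^esub> x" x i] that h_0[of i] by (simp add: M.l_neg eq_neg_iff_add_eq_0)
  obtain A where A: "finite A" "A \<subseteq> carrier M" "\<And>N. Module.submodule N ring_of_integers M \<Longrightarrow> A \<subseteq> N \<Longrightarrow> N = carrier M"
    using fg unfolding finitely_generated_def by blast
  define J where "J = (\<Union>a\<in>A. {i. h a i \<noteq> 0})"
  have "finite J" unfolding J_def using A h_fin by blast
  \<comment> \<open>The elements supported in \<open>J\<close> form a submodule containing the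
    generators, hence all of \<open>M\<close>.\<close>
  define N where "N = {x \<in> carrier M. \<forall>i. i \<notin> J \<longrightarrow> h x i = 0}"
  have "Module.submodule N ring_of_integers M"
  proof (rule submoduleI)
    show "\<ominus>\<^bsub>M\<^esub> x \<in> N" if "x \<in> N" for x using that h_inv by (auto simp: N_def)
    show "x \<oplus>\<^bsub>M\<^esub> y \<in> N" if "x \<in> N" "y \<in> N" for x y using that h_add by (auto simp: N_def)
    show "a \<odot>\<^bsub>M\<^esub> x \<in> N" if "a \<in> carrier ring_of_integers" "x \<in> N" for a x
      using that h_smult by (auto simp: N_def)
  qed (auto simp: N_def h_0)
  then have "N = carrier M" by (rule A(3)) (use A(2) in \<open>auto simp: N_def J_def\<close>)
  then have supp: "h x i = 0" if "x \<in> carrier M" "i \<notin> J" for x i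
    using that by (auto simp: N_def)
  obtain L :: "('k \<Rightarrow> int) set" where L: "finite L"
    "\<And>l x y. l \<in> L \<Longrightarrow> algebraic_int x \<Longrightarrow> algebraic_int y \<Longrightarrow> l (x + y) = l x + l y"
    "\<And>x. algebraic_int x \<Longrightarrow> \<forall>l\<in>L. l x = 0 \<Longrightarrow> x = 0"
    using ring_of_integers_separating_homs[OF nf R.is_cring] by blast
  define F where "F = (\<lambda>(l, i) x. l (h x i)) ` (L \<times> J)"
  show ?thesis
  proof (rule exists_dual_basis)
    show "finite F" using L(1) \<open>finite J\<close> by (simp add: F_def)
    show "comm_group (add_monoid M)" by (rule M.a_comm_group)
    show "F \<subseteq> hom (add_monoid M) integer_group"
      by (auto simp: F_def hom_def h_add h_int L(2))
    fix x assume "x \<in> carrier (add_monoid M)" and 0: "\<forall>f\<in>F. f x = 0"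
    then have x: "x \<in> carrier M" by simp
    have "h x i = h \<zero>\<^bsub>M\<^esub> i" for i
    proof (cases "i \<in> J")
      case True
      then show ?thesis using 0 by (subst L(3)[OF h_int[OF x]]) (auto simp: F_def h_0)
    qed (simp add: supp x)
    then have "h x = h \<zero>\<^bsub>M\<^esub>" by blast
    then show "x = \<one>\<^bsub>add_monoid M\<^esub>"
      using bij x by (auto simp: bij_betw_def dest: inj_onD)
  qed
qed

section \<open>Divisible endomorphisms\<close>

text \<open>On a dual basis of \<open>M\<close>, endomorphisms become integer matrices, composition
  becomes multiplication and injectivity of \<open>T\<close> a nonzero determinant, so the matrix
  result applies.\<close>

theorem divisible_endomorphism_roots_finite_order:
  fixes M :: "('k::field_char_0, 'm, 'x) module_scheme" and S :: "nat set" and T :: "'m \<Rightarrow> 'm"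
  defines "E \<equiv> module_End ring_of_integers M"
  assumes "number_field TYPE('k)" and M: "module ring_of_integers M"
    and "finitely_generated ring_of_integers M" and "projective_module ring_of_integers M"
    and S: "infinite S" "\<forall>s\<in>S. 0 < s"
    and T: "T \<in> carrier E" "inj_on T (carrier M)" "S_divisible S E T"
  shows "\<exists>N>0::nat. \<forall>s\<in>S. \<forall>f\<in>carrier E. f [^]\<^bsub>E\<^esub> s = T \<longrightarrow> f [^]\<^bsub>E\<^esub> N = \<one>\<^bsub>E\<^esub>"
proof -
  interpret M: module ring_of_integers M by fact
  interpret E: monoid E unfolding E_def by (rule monoid_module_End[OF M])
  let ?G = "add_monoid M"
  have G: "group ?G" using M.M.a_comm_group by (rule comm_group.axioms)
  obtain r v c where b: "dual_basis ?G r v c"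
    using projective_module_dual_basis[OF assms(2-5)] by blast
  let ?m = "matrix_of r v c"
  have hom: "f \<in> hom ?G ?G" if "f \<in> carrier E" for f
    using that by (auto simp: E_def module_End_def Defs.module_hom_def)
  have mult: "?m (f \<otimes>\<^bsub>E\<^esub> g) = ?m f * ?m g" if "f \<in> carrier E" "g \<in> carrier E" for f g
    by (rule matrix_of_mult[OF b hom[OF that(1)] hom[OF that(2)]]) (simp add: E_def module_End_def compose_def)
  have one: "?m \<one>\<^bsub>E\<^esub> = 1\<^sub>m r"
    by (rule matrix_of_one[OF b]) (simp add: E_def module_End_def)
  have pow: "?m (f [^]\<^bsub>E\<^esub> (n::nat)) = ?m f ^\<^sub>m n" if "f \<in> carrier E" for f n
  proof (induction n)
    case (Suc n)
    then show ?case using that by (simp add: mult)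
  qed (simp add: one)
  have det: "det (?m T) \<noteq> 0"
    using T(2) by (intro det_matrix_of_nonzero[OF G b hom[OF T(1)]]) simp
  have root: "\<forall>s\<in>S. \<exists>Y\<in>carrier_mat r r. Y ^\<^sub>m s = ?m T"
  proof
    fix s assume "s \<in> S"
    then obtain f where "f \<in> carrier E" "f [^]\<^bsub>E\<^esub> s = T" using T(3) by (auto simp: S_divisible_def)
    then show "\<exists>Y\<in>carrier_mat r r. Y ^\<^sub>m s = ?m T" using pow[of f s] by (intro bexI[of _ "?m f"]) auto
  qed
  obtain N where N: "N > 0" "\<And>s Y. s \<in> S \<Longrightarrow> Y \<in> carrier_mat r r \<Longrightarrow> Y ^\<^sub>m s = ?m T \<Longrightarrow> Y ^\<^sub>m N = 1\<^sub>m r"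
    using divisible_int_mat_roots_finite_order[OF matrix_of_carrier(1) det S root] by blast
  have "f [^]\<^bsub>E\<^esub> N = \<one>\<^bsub>E\<^esub>" if s: "s \<in> S" and f: "f \<in> carrier E" "f [^]\<^bsub>E\<^esub> s = T" for s f
  proof -
    have fN: "f [^]\<^bsub>E\<^esub> N \<in> carrier E" using f(1) by simp
    have "?m (f [^]\<^bsub>E\<^esub> N) = ?m \<one>\<^bsub>E\<^esub>"
      using N(2)[OF s matrix_of_carrier(1)[of r v c f]] pow[OF f(1)] f(2) by (metis one)
    then have eq: "(f [^]\<^bsub>E\<^esub> N) x = \<one>\<^bsub>E\<^esub> x" if "x \<in> carrier M" for x
      using matrix_of_inj[OF G b hom[OF fN] hom[OF E.one_closed], of x] that by simp
    \<comment> \<open>Equal matrices give equality on \<open>carrier M\<close> only; extensionality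
      makes it an equality of functions.\<close>
    have "f [^]\<^bsub>E\<^esub> N \<in> extensional (carrier M)" "\<one>\<^bsub>E\<^esub> \<in> extensional (carrier M)"
      using fN E.one_closed by (auto simp: E_def module_End_def)
    then show ?thesis by (rule extensionalityI) (rule eq)
  qed
  with N(1) show ?thesis by blast
qed

section \<open>Orders of elements and the primes in \<open>Pi_set\<close>\<close>

text \<open>Endomorphisms form only a monoid. The remainder of \<open>m\<close> modulo the order is
  again an exponent giving \<open>\<one>\<close>, and it is below the least positive one.\<close>

lemma (in monoid) order_of_dvd:
  assumes "x \<in> carrier G" "x [^] (m::nat) = \<one>" "m > 0"
  shows "order_of G x dvd m" "x [^] order_of G x = \<one>"
proof -
  let ?P = "\<lambda>n::nat. 0 < n \<and> x [^] n = \<one>"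
  have "?P (order_of G x)" unfolding order_of_def by (rule LeastI[of ?P m]) (use assms in simp)
  then show 1: "x [^] order_of G x = \<one>" by simp
  have "x [^] m = x [^] (order_of G x * (m div order_of G x)) \<otimes> x [^] (m mod order_of G x)"
    using assms(1) by (simp add: nat_pow_mult)
  also have "x [^] (order_of G x * (m div order_of G x)) = \<one>"
    using assms(1) 1 by (simp flip: nat_pow_pow)
  finally have "x [^] (m mod order_of G x) = \<one>" using assms by simp
  moreover have "m mod order_of G x < order_of G x" using \<open>?P (order_of G x)\<close> by simp
  then have "\<not> ?P (m mod order_of G x)" unfolding order_of_def by (rule not_less_Least)
  ultimately show "order_of G x dvd m" by auto
qed

lemma Pi_set_iff:
  "p \<in> Pi_set S \<longleftrightarrow> Factorial_Ring.prime p \<and> (\<forall>k. \<exists>s\<in>S. k \<le> multiplicity p s)"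
proof -
  have "(SUP s\<in>S. enat (multiplicity p s)) = \<infinity> \<longleftrightarrow> (\<forall>k. \<exists>s\<in>S. k \<le> multiplicity p s)"
  proof
    assume sup: "(SUP s\<in>S. enat (multiplicity p s)) = \<infinity>"
    show "\<forall>k. \<exists>s\<in>S. k \<le> multiplicity p s"
    proof (rule ccontr)
      assume "\<not> ?thesis"
      then obtain k where "\<forall>s\<in>S. multiplicity p s \<le> k" by (auto simp: not_le intro: less_imp_le)
      then have "(SUP s\<in>S. enat (multiplicity p s)) \<le> enat k" by (intro SUP_least) auto
      then show False using sup by simp
    qed
  next
    assume *: "\<forall>k. \<exists>s\<in>S. k \<le> multiplicity p s"
    have "enat k \<le> (SUP s\<in>S. enat (multiplicity p s))" for k
      using * by (meson SUP_upper2 enat_ord_simps(1))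
    then show "(SUP s\<in>S. enat (multiplicity p s)) = \<infinity>"
      by (metis enat.exhaust enat_ord_simps(1) not_less_eq_eq order_refl)
  qed
  then show ?thesis by (simp add: Pi_set_def)
qed

theorem corollary1p9:
  fixes M :: "('k::field_char_0, 'm, 'x) module_scheme"
    and S :: "nat set"
    and T :: "'m \<Rightarrow> 'm"
  assumes "number_field TYPE('k)"
    and "module ring_of_integers M"
    and "finitely_generated ring_of_integers M"
    and "projective_module ring_of_integers M"
    and "infinite S"
    and "\<forall>s\<in>S. 0 < s"
    and "T \<in> carrier (module_End ring_of_integers M)"
    and "inj_on T (carrier M)"
    and "S_divisible S (module_End ring_of_integers M) T"
  shows "has_finite_order (module_End ring_of_integers M) T \<and>
         (\<forall>p\<in>Pi_set S. coprime (order_of (module_End ring_of_integers M) T) p) \<and>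
         ((\<forall>p::nat. Factorial_Ring.prime p \<longrightarrow> (\<forall>k::nat. \<exists>s\<in>S. p ^ k dvd s)) \<longrightarrow>
           T = \<one>\<^bsub>module_End ring_of_integers M\<^esub>)"
proof -
  define E where "E = module_End ring_of_integers M"
  interpret E: monoid E unfolding E_def by (rule monoid_module_End[OF assms(2)])
  have TE: "T \<in> carrier E" using assms(7) by (simp add: E_def)
  obtain N :: nat where N: "N > 0" "\<And>s f. s \<in> S \<Longrightarrow> f \<in> carrier E \<Longrightarrow> f [^]\<^bsub>E\<^esub> s = T \<Longrightarrow> f [^]\<^bsub>E\<^esub> N = \<one>\<^bsub>E\<^esub>"
    using divisible_endomorphism_roots_finite_order[OF assms, folded E_def] by blast
  have root: "\<exists>f\<in>carrier E. f [^]\<^bsub>E\<^esub> s = T" if "s \<in> S" for s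
    using assms(9) that by (simp add: S_divisible_def E_def)
  \<comment> \<open>For a root \<open>f\<close> of exponent \<open>s\<close>, the power
    \<open>T ^ m\<close> is \<open>f ^ (s * m)\<close>, a power of \<open>f ^ N\<close>.\<close>
  have T_pow: "T [^]\<^bsub>E\<^esub> m = \<one>\<^bsub>E\<^esub>" if s: "s \<in> S" and dvd: "N dvd s * m" for s m :: nat
  proof -
    obtain f where f: "f \<in> carrier E" "f [^]\<^bsub>E\<^esub> s = T" using root[OF s] by blast
    obtain q where q: "s * m = N * q" using dvd by (auto simp: dvd_def)
    have "T [^]\<^bsub>E\<^esub> m = f [^]\<^bsub>E\<^esub> (s * m)" using f by (simp flip: E.nat_pow_pow)
    also have "\<dots> = (f [^]\<^bsub>E\<^esub> N) [^]\<^bsub>E\<^esub> q" unfolding q using f(1) by (simp add: E.nat_pow_pow)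
    finally show ?thesis using N(2)[OF s f] by simp
  qed
  obtain s where "s \<in> S" using assms(5) by fastforce
  then have TN: "T [^]\<^bsub>E\<^esub> N = \<one>\<^bsub>E\<^esub>" using T_pow[of s N] by simp
  have coprime: "coprime (order_of E T) p" if Pi: "p \<in> Pi_set S" for p
  proof -
    have p: "Factorial_Ring.prime p" using Pi by (simp add: Pi_set_iff)
    \<comment> \<open>An \<open>s\<close> divisible by the full power of \<open>p\<close> in
      \<open>N\<close> leaves the part \<open>m\<close> of \<open>N\<close> prime to
      \<open>p\<close> as an exponent for \<open>T\<close>.\<close>
    obtain s where s: "s \<in> S" "multiplicity p N \<le> multiplicity p s" using Pi unfolding Pi_set_iff by blast
    obtain m where m: "N = p ^ multiplicity p N * m" "\<not> p dvd m"
      using multiplicity_decompose'[of N p] N(1) prime_gt_1_nat[OF p] by auto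
    have "p ^ multiplicity p N dvd s" using s(2) by (rule multiplicity_dvd')
    then have "N dvd s * m" by (subst m(1)) (rule mult_dvd_mono, auto)
    then have "T [^]\<^bsub>E\<^esub> m = \<one>\<^bsub>E\<^esub>" by (rule T_pow[OF s(1)])
    moreover have "m > 0" using m N(1) by (cases m) auto
    ultimately have "order_of E T dvd m" using E.order_of_dvd(1)[OF TE] by blast
    then have "\<not> p dvd order_of E T" using m(2) dvd_trans by blast
    with p have "coprime p (order_of E T)" by (rule prime_imp_coprime_nat)
    then show ?thesis by (simp add: coprime_commute)
  qed
  have "T = \<one>\<^bsub>E\<^esub>" if all: "\<forall>p::nat. Factorial_Ring.prime p \<longrightarrow> (\<forall>k::nat. \<exists>s\<in>S. p ^ k dvd s)"
  proof -
    have Pi: "p \<in> Pi_set S" if p: "Factorial_Ring.prime p" for p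
      unfolding Pi_set_iff
    proof (intro conjI allI p)
      fix k
      obtain s where s: "s \<in> S" "p ^ k dvd s" using all p by blast
      \<comment> \<open>Divisibility by \<open>p ^ k\<close> bounds the multiplicity from below
        because \<open>s\<close> is positive.\<close>
      then have "k \<le> multiplicity p s"
        using assms(6) p by (intro multiplicity_geI) auto
      then show "\<exists>s\<in>S. k \<le> multiplicity p s" using s(1) by blast
    qed
    \<comment> \<open>Now every prime lies in \<open>Pi_set S\<close>, so the order has no prime
      divisor and equals 1.\<close>
    have "\<not> p dvd order_of E T" if "Factorial_Ring.prime p" for p
    proof
      assume "p dvd order_of E T"
      with coprime[OF Pi[OF that]] have "p dvd 1" by (meson coprime_common_divisor dvd_refl)
      then show False using that by simp
    qed
    then have "order_of E T = 1" using prime_factor_nat[of "order_of E T"] by blast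
    then show ?thesis using E.order_of_dvd(2)[OF TE TN N(1)] TE by simp
  qed
  moreover have "has_finite_order E T" unfolding has_finite_order_def using N(1) TN by blast
  ultimately show ?thesis unfolding E_def using coprime[unfolded E_def] by blast
qed

end
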